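(* The assignments $S\mapsto K_0S$ on semirings and $f\mapsto K_0f$ on semiring homomorphisms define a functor $K_0$ from the category of (unital) semirings, with identity-preserving semiring homomorphisms, to the category of Abelian groups with group homomorphisms.
   Context: A semiring $\langle S,+,\cdot,0,1\rangle$: $\langle S,+,0\rangle$ is a commutative monoid, $\langle S,\cdot,1\rangle$ is a monoid, $\cdot$ distributes over $+$ from both sides, and $0\cdot a=0=a\cdot 0$. Semiring homomorphisms preserve $+,\cdot,0,1$. A left $S$-semimodule is a commutative monoid with a scalar multiplication by $S$ satisfying $(ab)x=a(bx)$, $a(x+y)=ax+ay$, $(a+b)x=ax+bx$, $0_S x=0=a0$, $1x=x$. A semimodule is projective if every homomorphism from it lifts along every surjective homomorphism. For a semiring $S$, $\mathrm{P_F}(S)$ is the Abelian monoid of isomorphism classes $[P]$ of finitely generated projective left $S$-semimodules under direct sum, with neutral element $[\{0\}]$. Let $J$ be the free Abelian group generated by the set $\mathrm{P_F}(S)$ and $H$ its subgroup generated by all $[P]+[Q]-[P\oplus Q]$. The Grothendieck group of $S$ is $K_0S=J/H$; $k_S:\mathrm{P_F}(S)\to K_0S$, $[P]\mapsto[P]/H$, is a monoid homomorphism. Every finitely generated projective left $S$-semimodule is isomorphic, for some $n$, to $S\cdot(u_{ij})_{i,j=1}^n$, the subsemimodule of $S^n$ generated by the rows of an $n\times n$ matrix over $S$ that is idempotent for the product $(a_{ij})\star(b_{ij})=\left(\sum_k a_{ik}b_{kj}\right)$. A semiring homomorphism $f:S\to T$ induces the monoid homomorphism $\hat f:\mathrm{P_F}(S)\to\mathrm{P_F}(T)$,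 $[S\cdot(u_{ij})]\mapsto[T\cdot(f(u_{ij}))]$ ($(u_{ij})$ idempotent), and $K_0f:K_0S\to K_0T$ is the unique group homomorphism with $K_0f\circ k_S=k_T\circ\hat f$. *)

theory Defs
  imports "HOL-Algebra.Module" "HOL-Algebra.Free_Abelian_Groups"
begin

section \<open>Semirings and left semimodules\<close>

text \<open>
  Semirings are those of the locale \<^locale>\<open>semiring\<close>; they need not satisfy \<open>0 \<noteq> 1\<close>.
  \<open>ring_hom\<close> asks for preservation of addition, multiplication and one only;
  over semirings preservation of zero has to be added.
\<close>

definition semiring_hom :: "'a ring \<Rightarrow> 'b ring \<Rightarrow> ('a \<Rightarrow> 'b) set"
  where "semiring_hom S T = {f \<in> ring_hom S T. f \<zero>\<^bsub>S\<^esub> = \<zero>\<^bsub>T\<^esub>}"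

text \<open>
  Semimodules use the record type \<open>module\<close>, whose inherited fields \<open>mult\<close> and \<open>one\<close> are ignored.
\<close>

locale left_semimodule = S?: semiring S + M?: abelian_monoid M
    for S :: "'a ring" (structure) and M :: "('a, 'm) module" (structure) +
  assumes smult_closed [simp, intro]:
      "\<lbrakk>a \<in> carrier S; x \<in> carrier M\<rbrakk> \<Longrightarrow> a \<odot>\<^bsub>M\<^esub> x \<in> carrier M"
    and smult_assoc:
      "\<lbrakk>a \<in> carrier S; b \<in> carrier S; x \<in> carrier M\<rbrakk> \<Longrightarrow>
        (a \<otimes>\<^bsub>S\<^esub> b) \<odot>\<^bsub>M\<^esub> x = a \<odot>\<^bsub>M\<^esub> (b \<odot>\<^bsub>M\<^esub> x)"
    and smult_r_distr:
      "\<lbrakk>a \<in> carrier S; x \<in> carrier M; y \<in> carrier M\<rbrakk> \<Longrightarrow>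
        a \<odot>\<^bsub>M\<^esub> (x \<oplus>\<^bsub>M\<^esub> y) = a \<odot>\<^bsub>M\<^esub> x \<oplus>\<^bsub>M\<^esub> a \<odot>\<^bsub>M\<^esub> y"
    and smult_l_distr:
      "\<lbrakk>a \<in> carrier S; b \<in> carrier S; x \<in> carrier M\<rbrakk> \<Longrightarrow>
        (a \<oplus>\<^bsub>S\<^esub> b) \<odot>\<^bsub>M\<^esub> x = a \<odot>\<^bsub>M\<^esub> x \<oplus>\<^bsub>M\<^esub> b \<odot>\<^bsub>M\<^esub> x"
    and smult_l_zero [simp]: "x \<in> carrier M \<Longrightarrow> \<zero>\<^bsub>S\<^esub> \<odot>\<^bsub>M\<^esub> x = \<zero>\<^bsub>M\<^esub>"
    and smult_r_zero [simp]: "a \<in> carrier S \<Longrightarrow> a \<odot>\<^bsub>M\<^esub> \<zero>\<^bsub>M\<^esub> = \<zero>\<^bsub>M\<^esub>"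
    and smult_one [simp]: "x \<in> carrier M \<Longrightarrow> \<one>\<^bsub>S\<^esub> \<odot>\<^bsub>M\<^esub> x = x"

definition semimodule_hom :: "'a ring \<Rightarrow> ('a, 'm) module \<Rightarrow> ('a, 'n) module \<Rightarrow> ('m \<Rightarrow> 'n) set"
  where "semimodule_hom S M N =
    {h \<in> carrier M \<rightarrow> carrier N.
       h \<zero>\<^bsub>M\<^esub> = \<zero>\<^bsub>N\<^esub> \<and>
       (\<forall>x\<in>carrier M. \<forall>y\<in>carrier M. h (x \<oplus>\<^bsub>M\<^esub> y) = h x \<oplus>\<^bsub>N\<^esub> h y) \<and>
       (\<forall>a\<in>carrier S. \<forall>x\<in>carrier M. h (a \<odot>\<^bsub>M\<^esub> x) = a \<odot>\<^bsub>N\<^esub> h x)}"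

definition semimodule_iso :: "'a ring \<Rightarrow> ('a, 'm) module \<Rightarrow> ('a, 'n) module \<Rightarrow> bool"
  where "semimodule_iso S M N \<longleftrightarrow>
    (\<exists>h\<in>semimodule_hom S M N. bij_betw h (carrier M) (carrier N))"

definition subsemimodule :: "'a ring \<Rightarrow> ('a, 'm) module \<Rightarrow> 'm set \<Rightarrow> bool"
  where "subsemimodule S M A \<longleftrightarrow>
    A \<subseteq> carrier M \<and> \<zero>\<^bsub>M\<^esub> \<in> A \<and> (\<forall>x\<in>A. \<forall>y\<in>A. x \<oplus>\<^bsub>M\<^esub> y \<in> A) \<and>
    (\<forall>a\<in>carrier S. \<forall>x\<in>A. a \<odot>\<^bsub>M\<^esub> x \<in> A)"

definition semimodule_span :: "'a ring \<Rightarrow> ('a, 'm) module \<Rightarrow> 'm set \<Rightarrow> 'm set"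
  where "semimodule_span S M X = \<Inter>{A. subsemimodule S M A \<and> X \<subseteq> A}"

definition finitely_generated :: "'a ring \<Rightarrow> ('a, 'm) module \<Rightarrow> bool"
  where "finitely_generated S M \<longleftrightarrow>
    (\<exists>X. finite X \<and> X \<subseteq> carrier M \<and> semimodule_span S M X = carrier M)"

text \<open>
  The test semimodules range over the type \<^typ>\<open>nat \<Rightarrow> 'a\<close>, which contains all the free
  semimodules \<open>S\<^sup>n\<close> and, up to isomorphism, all their quotients. For finitely generated
  semimodules this is no restriction: see \<open>fg_projective_lifts\<close> below, where
  the test semimodules are over arbitrary types.
\<close>

definition projective :: "'a ring \<Rightarrow> ('a, 'm) module \<Rightarrow> bool"
  where "projective S P \<longleftrightarrow>
    (\<forall>(M :: ('a, nat \<Rightarrow> 'a) module) (N :: ('a, nat \<Rightarrow> 'a) module) g h.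
       left_semimodule S M \<longrightarrow> left_semimodule S N \<longrightarrow>
       g \<in> semimodule_hom S M N \<longrightarrow> g ` carrier M = carrier N \<longrightarrow> h \<in> semimodule_hom S P N \<longrightarrow>
       (\<exists>h'\<in>semimodule_hom S P M. \<forall>x\<in>carrier P. g (h' x) = h x))"

definition fg_projective :: "'a ring \<Rightarrow> ('a, 'm) module \<Rightarrow> bool"
  where "fg_projective S P \<longleftrightarrow>
    left_semimodule S P \<and> finitely_generated S P \<and> projective S P"

definition zero_semimodule :: "('a, unit) module"
  where "zero_semimodule =
    \<lparr>carrier = {()}, monoid.mult = undefined, one = undefined,
     ring.zero = (), ring.add = (\<lambda>_ _. ()), smult = (\<lambda>_ _. ())\<rparr>"

definition direct_sum :: "('a, 'm) module \<Rightarrow> ('a, 'n) module \<Rightarrow> ('a, 'm \<times> 'n) module"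
  where "direct_sum M N =
    \<lparr>carrier = carrier M \<times> carrier N, monoid.mult = undefined, one = undefined,
     ring.zero = (\<zero>\<^bsub>M\<^esub>, \<zero>\<^bsub>N\<^esub>),
     ring.add = (\<lambda>(x, y) (x', y'). (x \<oplus>\<^bsub>M\<^esub> x', y \<oplus>\<^bsub>N\<^esub> y')),
     smult = (\<lambda>a (x, y). (a \<odot>\<^bsub>M\<^esub> x, a \<odot>\<^bsub>N\<^esub> y))\<rparr>"

definition free_semimodule :: "'a ring \<Rightarrow> nat \<Rightarrow> ('a, nat \<Rightarrow> 'a) module"
  where "free_semimodule S n =
    \<lparr>carrier = {..<n} \<rightarrow>\<^sub>E carrier S, monoid.mult = undefined, one = undefined,
     ring.zero = (\<lambda>i\<in>{..<n}. \<zero>\<^bsub>S\<^esub>),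
     ring.add = (\<lambda>x y. \<lambda>i\<in>{..<n}. x i \<oplus>\<^bsub>S\<^esub> y i),
     smult = (\<lambda>a x. \<lambda>i\<in>{..<n}. a \<otimes>\<^bsub>S\<^esub> x i)\<rparr>"

lemma (in left_semimodule) smult_finsum:
  assumes "a \<in> carrier S" "finite I" "y \<in> I \<rightarrow> carrier M"
  shows "a \<odot>\<^bsub>M\<^esub> (\<Oplus>\<^bsub>M\<^esub>i\<in>I. y i) = (\<Oplus>\<^bsub>M\<^esub>i\<in>I. a \<odot>\<^bsub>M\<^esub> y i)"
  using assms(2,3)
proof (induction I rule: finite_induct)
  case empty
  then show ?case using assms(1) by simp
next
  case (insert i I)
  then have "y i \<in> carrier M" "y \<in> I \<rightarrow> carrier M" by auto
  with insert assms(1) show ?case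
    by (simp add: smult_r_distr Pi_def)
qed

lemma left_semimodule_free:
  assumes "semiring S"
  shows "left_semimodule S (free_semimodule S n)"
proof -
  interpret S: semiring S by fact
  have ext: "x = y" if "x \<in> {..<n} \<rightarrow>\<^sub>E carrier S" "y \<in> {..<n} \<rightarrow>\<^sub>E carrier S"
      "\<And>i. i < n \<Longrightarrow> x i = y i" for x y
    using that by (auto intro: PiE_ext)
  have "abelian_monoid (free_semimodule S n)"
  proof (rule abelian_monoidI)
    fix x y z
    assume "x \<in> carrier (free_semimodule S n)" "y \<in> carrier (free_semimodule S n)"
      "z \<in> carrier (free_semimodule S n)"
    then show "(x \<oplus>\<^bsub>free_semimodule S n\<^esub> y) \<oplus>\<^bsub>free_semimodule S n\<^esub> z =
        x \<oplus>\<^bsub>free_semimodule S n\<^esub> (y \<oplus>\<^bsub>free_semimodule S n\<^esub> z)"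
      by (auto simp: free_semimodule_def PiE_iff S.a_assoc intro!: ext split: if_splits)
  next
    fix x y
    assume "x \<in> carrier (free_semimodule S n)" "y \<in> carrier (free_semimodule S n)"
    then show "x \<oplus>\<^bsub>free_semimodule S n\<^esub> y = y \<oplus>\<^bsub>free_semimodule S n\<^esub> x"
      by (auto simp: free_semimodule_def PiE_iff S.a_comm intro!: ext split: if_splits)
  next
    fix x assume "x \<in> carrier (free_semimodule S n)"
    then show "\<zero>\<^bsub>free_semimodule S n\<^esub> \<oplus>\<^bsub>free_semimodule S n\<^esub> x = x"
      by (intro ext) (auto simp: free_semimodule_def PiE_iff)
  qed (auto simp: free_semimodule_def PiE_iff)
  then interpret F: abelian_monoid "free_semimodule S n" .
  show ?thesis
  proof
    fix a b x
    assume "a \<in> carrier S" "b \<in> carrier S" "x \<in> carrier (free_semimodule S n)"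
    then show "a \<otimes>\<^bsub>S\<^esub> b \<odot>\<^bsub>free_semimodule S n\<^esub> x =
        a \<odot>\<^bsub>free_semimodule S n\<^esub> (b \<odot>\<^bsub>free_semimodule S n\<^esub> x)"
      by (auto simp: free_semimodule_def PiE_iff S.m_assoc intro!: ext split: if_splits)
  next
    fix a b x
    assume "a \<in> carrier S" "b \<in> carrier S" "x \<in> carrier (free_semimodule S n)"
    then show "(a \<oplus>\<^bsub>S\<^esub> b) \<odot>\<^bsub>free_semimodule S n\<^esub> x =
        a \<odot>\<^bsub>free_semimodule S n\<^esub> x \<oplus>\<^bsub>free_semimodule S n\<^esub> b \<odot>\<^bsub>free_semimodule S n\<^esub> x"
      by (auto simp: free_semimodule_def PiE_iff S.l_distr intro!: ext split: if_splits)
  next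
    fix a x y
    assume "a \<in> carrier S" "x \<in> carrier (free_semimodule S n)" "y \<in> carrier (free_semimodule S n)"
    then show "a \<odot>\<^bsub>free_semimodule S n\<^esub> (x \<oplus>\<^bsub>free_semimodule S n\<^esub> y) =
        a \<odot>\<^bsub>free_semimodule S n\<^esub> x \<oplus>\<^bsub>free_semimodule S n\<^esub> a \<odot>\<^bsub>free_semimodule S n\<^esub> y"
      by (auto simp: free_semimodule_def PiE_iff S.r_distr intro!: ext split: if_splits)
  next
    fix x assume "x \<in> carrier (free_semimodule S n)"
    then show "\<one>\<^bsub>S\<^esub> \<odot>\<^bsub>free_semimodule S n\<^esub> x = x"
      by (intro ext) (auto simp: free_semimodule_def PiE_iff)
  qed (auto simp: free_semimodule_def PiE_iff intro!: restrict_ext)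
qed

lemma (in left_semimodule) linear_combination_hom:
  assumes m: "m \<in> {..<n} \<rightarrow> carrier M"
  shows "(\<lambda>c. \<Oplus>\<^bsub>M\<^esub>i\<in>{..<n}. c i \<odot>\<^bsub>M\<^esub> m i) \<in> semimodule_hom S (free_semimodule S n) M"
proof -
  have cl: "c i \<odot>\<^bsub>M\<^esub> m i \<in> carrier M" if "c \<in> {..<n} \<rightarrow>\<^sub>E carrier S" "i < n" for c i
    using that m by (auto simp: PiE_iff Pi_iff)
  have 1: "(\<Oplus>\<^bsub>M\<^esub>i\<in>{..<n}. (\<lambda>i\<in>{..<n}. c i \<oplus>\<^bsub>S\<^esub> d i) i \<odot>\<^bsub>M\<^esub> m i) =
      (\<Oplus>\<^bsub>M\<^esub>i\<in>{..<n}. c i \<odot>\<^bsub>M\<^esub> m i) \<oplus>\<^bsub>M\<^esub> (\<Oplus>\<^bsub>M\<^esub>i\<in>{..<n}. d i \<odot>\<^bsub>M\<^esub> m i)"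
    if "c \<in> {..<n} \<rightarrow>\<^sub>E carrier S" "d \<in> {..<n} \<rightarrow>\<^sub>E carrier S" for c d
  proof -
    have "(\<Oplus>\<^bsub>M\<^esub>i\<in>{..<n}. (\<lambda>i\<in>{..<n}. c i \<oplus>\<^bsub>S\<^esub> d i) i \<odot>\<^bsub>M\<^esub> m i) =
        (\<Oplus>\<^bsub>M\<^esub>i\<in>{..<n}. c i \<odot>\<^bsub>M\<^esub> m i \<oplus>\<^bsub>M\<^esub> d i \<odot>\<^bsub>M\<^esub> m i)"
      using that m by (intro M.finsum_cong') (auto simp: PiE_iff Pi_iff smult_l_distr)
    then show ?thesis
      using that by (simp add: M.finsum_addf cl Pi_iff)
  qed
  have 2: "(\<Oplus>\<^bsub>M\<^esub>i\<in>{..<n}. (\<lambda>i\<in>{..<n}. a \<otimes>\<^bsub>S\<^esub> c i) i \<odot>\<^bsub>M\<^esub> m i) =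
      a \<odot>\<^bsub>M\<^esub> (\<Oplus>\<^bsub>M\<^esub>i\<in>{..<n}. c i \<odot>\<^bsub>M\<^esub> m i)"
    if "a \<in> carrier S" "c \<in> {..<n} \<rightarrow>\<^sub>E carrier S" for a c
  proof -
    have "(\<Oplus>\<^bsub>M\<^esub>i\<in>{..<n}. (\<lambda>i\<in>{..<n}. a \<otimes>\<^bsub>S\<^esub> c i) i \<odot>\<^bsub>M\<^esub> m i) =
        (\<Oplus>\<^bsub>M\<^esub>i\<in>{..<n}. a \<odot>\<^bsub>M\<^esub> (c i \<odot>\<^bsub>M\<^esub> m i))"
      using that m by (intro M.finsum_cong') (auto simp: PiE_iff Pi_iff smult_assoc)
    then show ?thesis
      using that by (simp add: smult_finsum cl Pi_iff)
  qed
  have 3: "(\<Oplus>\<^bsub>M\<^esub>i\<in>{..<n}. (\<lambda>i\<in>{..<n}. \<zero>\<^bsub>S\<^esub>) i \<odot>\<^bsub>M\<^esub> m i) = \<zero>\<^bsub>M\<^esub>"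
  proof -
    have "(\<Oplus>\<^bsub>M\<^esub>i\<in>{..<n}. (\<lambda>i\<in>{..<n}. \<zero>\<^bsub>S\<^esub>) i \<odot>\<^bsub>M\<^esub> m i) = (\<Oplus>\<^bsub>M\<^esub>i\<in>{..<n}. \<zero>\<^bsub>M\<^esub>)"
      using m by (intro M.finsum_cong') (auto simp: Pi_iff)
    then show ?thesis by simp
  qed
  show ?thesis
    using 1 2 3 cl by (auto simp: semimodule_hom_def free_semimodule_def Pi_iff intro!: M.finsum_closed)
qed

lemma semimodule_hom_finsum:
  assumes "left_semimodule S M" "left_semimodule S N" "h \<in> semimodule_hom S M N"
    and "finite I" "y \<in> I \<rightarrow> carrier M"
  shows "h (\<Oplus>\<^bsub>M\<^esub>i\<in>I. y i) = (\<Oplus>\<^bsub>N\<^esub>i\<in>I. h (y i))"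
proof -
  interpret M: left_semimodule S M by fact
  interpret N: left_semimodule S N by fact
  show ?thesis
    using assms(4,5)
  proof (induction I rule: finite_induct)
    case empty
    then show ?case using assms(3) by (simp add: semimodule_hom_def)
  next
    case (insert i I)
    then have "y i \<in> carrier M" "y \<in> I \<rightarrow> carrier M" by auto
    moreover have "(\<lambda>i. h (y i)) \<in> I \<rightarrow> carrier N" "h (y i) \<in> carrier N"
      using insert.prems assms(3) by (auto simp: semimodule_hom_def)
    ultimately show ?case
      using insert assms(3) by (simp add: semimodule_hom_def)
  qed
qed

lemma finitely_generated_imp_quotient:
  assumes "left_semimodule S P" "finitely_generated S P"
  obtains n p where "p \<in> {..<n} \<rightarrow> carrier P"
    "(\<lambda>c. \<Oplus>\<^bsub>P\<^esub>i\<in>{..<n}. c i \<odot>\<^bsub>P\<^esub> p i) ` carrier (free_semimodule S n) = carrier P"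
proof -
  interpret P: left_semimodule S P by fact
  obtain B where B: "finite B" "B \<subseteq> carrier P" "semimodule_span S P B = carrier P"
    using assms(2) by (auto simp: finitely_generated_def)
  obtain n p where np: "B = p ` {i::nat. i < n}"
    using finite_imp_nat_seg_image_inj_on[OF B(1)] by blast
  have p: "p \<in> {..<n} \<rightarrow> carrier P" using B(2) np by auto
  define \<phi> where "\<phi> = (\<lambda>c. \<Oplus>\<^bsub>P\<^esub>i\<in>{..<n}. c i \<odot>\<^bsub>P\<^esub> p i)"
  have hom: "\<phi> \<in> semimodule_hom S (free_semimodule S n) P"
    unfolding \<phi>_def by (rule P.linear_combination_hom[OF p])
  interpret F: left_semimodule S "free_semimodule S n"
    by (rule left_semimodule_free) (rule P.S.semiring_axioms)
  have img: "\<phi> ` carrier (free_semimodule S n) \<subseteq> carrier P"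
    using hom by (auto simp: semimodule_hom_def)
  have "subsemimodule S P (\<phi> ` carrier (free_semimodule S n))"
    unfolding subsemimodule_def
  proof (intro conjI ballI)
    have "\<phi> \<zero>\<^bsub>free_semimodule S n\<^esub> = \<zero>\<^bsub>P\<^esub>"
      using hom by (simp add: semimodule_hom_def)
    then show "\<zero>\<^bsub>P\<^esub> \<in> \<phi> ` carrier (free_semimodule S n)"
      by (rule image_eqI[OF sym F.M.zero_closed])
  next
    fix x y assume "x \<in> \<phi> ` carrier (free_semimodule S n)" "y \<in> \<phi> ` carrier (free_semimodule S n)"
    then obtain c d where cd: "c \<in> carrier (free_semimodule S n)" "x = \<phi> c"
      "d \<in> carrier (free_semimodule S n)" "y = \<phi> d" by blast
    then have "x \<oplus>\<^bsub>P\<^esub> y = \<phi> (c \<oplus>\<^bsub>free_semimodule S n\<^esub> d)"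
      using hom by (simp add: semimodule_hom_def)
    then show "x \<oplus>\<^bsub>P\<^esub> y \<in> \<phi> ` carrier (free_semimodule S n)"
      using cd F.M.add.m_closed by blast
  next
    fix a x assume a: "a \<in> carrier S" and "x \<in> \<phi> ` carrier (free_semimodule S n)"
    then obtain c where c: "c \<in> carrier (free_semimodule S n)" "x = \<phi> c" by blast
    then have "a \<odot>\<^bsub>P\<^esub> x = \<phi> (a \<odot>\<^bsub>free_semimodule S n\<^esub> c)"
      using hom a by (simp add: semimodule_hom_def)
    then show "a \<odot>\<^bsub>P\<^esub> x \<in> \<phi> ` carrier (free_semimodule S n)"
      using c a F.smult_closed by blast
  qed (use img in auto)
  moreover have "B \<subseteq> \<phi> ` carrier (free_semimodule S n)"
  proof
    fix b assume "b \<in> B"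
    then obtain j where j: "j < n" "b = p j" using np by auto
    define e where "e = (\<lambda>i\<in>{..<n}. if i = j then \<one>\<^bsub>S\<^esub> else \<zero>\<^bsub>S\<^esub>)"
    have e: "e \<in> carrier (free_semimodule S n)"
      by (auto simp: e_def free_semimodule_def)
    have "\<phi> e = (\<Oplus>\<^bsub>P\<^esub>i\<in>{..<n}. if j = i then p i else \<zero>\<^bsub>P\<^esub>)"
      unfolding \<phi>_def e_def using p by (intro P.M.finsum_cong') (auto simp: Pi_iff)
    also have "\<dots> = p j"
      using j p by (intro P.M.finsum_singleton) auto
    finally show "b \<in> \<phi> ` carrier (free_semimodule S n)"
      using e j by (metis image_eqI)
  qed
  ultimately have "carrier P \<subseteq> \<phi> ` carrier (free_semimodule S n)"
    using B(3) by (auto simp: semimodule_span_def)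
  with img have "\<phi> ` carrier (free_semimodule S n) = carrier P" by blast
  with p show thesis unfolding \<phi>_def by (rule that)
qed

text \<open>
  Hence \<^const>\<open>fg_projective\<close> does not depend on the type the test semimodules are over.
\<close>

lemma fg_projective_lifts:
  fixes S :: "'a ring" and P :: "('a, 'p) module"
    and M :: "('a, 'm) module" and N :: "('a, 'n) module"
  assumes P: "fg_projective S P" and M: "left_semimodule S M" and N: "left_semimodule S N"
    and g: "g \<in> semimodule_hom S M N" "g ` carrier M = carrier N" and h: "h \<in> semimodule_hom S P N"
  shows "\<exists>h'\<in>semimodule_hom S P M. \<forall>x\<in>carrier P. g (h' x) = h x"
proof -
  interpret P: left_semimodule S P using P by (simp add: fg_projective_def)
  interpret M: left_semimodule S M by fact
  interpret N: left_semimodule S N by fact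
  obtain n p where p: "p \<in> {..<n} \<rightarrow> carrier P"
    and surj: "(\<lambda>c. \<Oplus>\<^bsub>P\<^esub>i\<in>{..<n}. c i \<odot>\<^bsub>P\<^esub> p i) ` carrier (free_semimodule S n) = carrier P"
    by (rule finitely_generated_imp_quotient[of S P]) (use P in \<open>auto simp: fg_projective_def\<close>)
  define \<phi> where "\<phi> = (\<lambda>c. \<Oplus>\<^bsub>P\<^esub>i\<in>{..<n}. c i \<odot>\<^bsub>P\<^esub> p i)"
  have \<phi>: "\<phi> \<in> semimodule_hom S (free_semimodule S n) P"
    unfolding \<phi>_def by (rule P.linear_combination_hom[OF p])
  have F: "left_semimodule S (free_semimodule S n)"
    by (rule left_semimodule_free) (rule P.S.semiring_axioms)
  define \<iota> where "\<iota> = inv_into (carrier (free_semimodule S n)) \<phi>"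
  have \<phi>\<iota>: "\<phi> (\<iota> x) = x" if "x \<in> carrier P" for x
    unfolding \<iota>_def
    by (rule f_inv_into_f[where f = \<phi>]) (use that surj[folded \<phi>_def] in simp)
  \<comment> \<open>a copy of \<open>P\<close> over the type \<^typ>\<open>nat \<Rightarrow> 'a\<close>\<close>
  define P' :: "('a, nat \<Rightarrow> 'a) module" where
    "P' = \<lparr>carrier = \<iota> ` carrier P, monoid.mult = undefined, one = undefined,
       ring.zero = \<iota> \<zero>\<^bsub>P\<^esub>, ring.add = (\<lambda>x y. \<iota> (\<phi> x \<oplus>\<^bsub>P\<^esub> \<phi> y)), smult = (\<lambda>a x. \<iota> (a \<odot>\<^bsub>P\<^esub> \<phi> x))\<rparr>"
  have "abelian_monoid P'"
    by (rule abelian_monoidI) (auto simp: P'_def \<phi>\<iota> P.M.a_assoc P.M.add.m_lcomm P.M.a_comm)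
  then interpret P': abelian_monoid P' .
  have P': "left_semimodule S P'"
    by unfold_locales
      (auto simp: P'_def \<phi>\<iota> P.smult_assoc P.smult_l_distr P.smult_r_distr)
  have "(\<lambda>c. \<iota> (\<phi> c)) \<in> semimodule_hom S (free_semimodule S n) P'"
    using \<phi> by (auto simp: semimodule_hom_def P'_def \<phi>\<iota> Pi_iff)
  moreover have "(\<lambda>c. \<iota> (\<phi> c)) ` carrier (free_semimodule S n) = carrier P'"
    using surj[folded \<phi>_def] by (simp add: P'_def image_image[symmetric])
  moreover have "\<iota> \<in> semimodule_hom S P P'"
    by (auto simp: semimodule_hom_def P'_def \<phi>\<iota>)
  moreover have "projective S P" using P by (simp add: fg_projective_def)
  ultimately have "\<exists>s\<in>semimodule_hom S P (free_semimodule S n). \<forall>x\<in>carrier P. \<iota> (\<phi> (s x)) = \<iota> x"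
    using F P' unfolding projective_def by blast
  then obtain s where s: "s \<in> semimodule_hom S P (free_semimodule S n)"
    and \<iota>s: "\<And>x. x \<in> carrier P \<Longrightarrow> \<iota> (\<phi> (s x)) = \<iota> x"
    by blast
  have \<phi>s: "\<phi> (s x) = x" if x: "x \<in> carrier P" for x
  proof -
    have "\<phi> (s x) \<in> carrier P" using x s \<phi> by (auto simp: semimodule_hom_def Pi_iff)
    then have "\<phi> (s x) = \<phi> (\<iota> (\<phi> (s x)))" by (simp add: \<phi>\<iota>)
    with x show ?thesis by (simp add: \<iota>s \<phi>\<iota>)
  qed
  have "\<forall>i\<in>{..<n}. \<exists>m\<in>carrier M. g m = h (p i)"
    proof
    fix i assume "i \<in> {..<n}"
    then have "h (p i) \<in> g ` carrier M" using p g(2) h by (auto simp: semimodule_hom_def Pi_iff)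
    then show "\<exists>m\<in>carrier M. g m = h (p i)" by (metis imageE)
  qed
  then obtain m where m: "\<forall>i\<in>{..<n}. m i \<in> carrier M \<and> g (m i) = h (p i)" by metis
  then have m': "m \<in> {..<n} \<rightarrow> carrier M" by auto
  define \<psi> where "\<psi> = (\<lambda>c. \<Oplus>\<^bsub>M\<^esub>i\<in>{..<n}. c i \<odot>\<^bsub>M\<^esub> m i)"
  have \<psi>: "\<psi> \<in> semimodule_hom S (free_semimodule S n) M"
    unfolding \<psi>_def by (rule M.linear_combination_hom[OF m'])
  have g\<psi>: "g (\<psi> c) = h (\<phi> c)" if c: "c \<in> carrier (free_semimodule S n)" for c
  proof -
    have ci: "c i \<in> carrier S" if "i < n" for i
      using c that by (auto simp: free_semimodule_def)
    have "g (\<psi> c) = (\<Oplus>\<^bsub>N\<^esub>i\<in>{..<n}. g (c i \<odot>\<^bsub>M\<^esub> m i))"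
      unfolding \<psi>_def using ci m' by (intro semimodule_hom_finsum[OF M N g(1)]) auto
    also have "\<dots> = (\<Oplus>\<^bsub>N\<^esub>i\<in>{..<n}. h (c i \<odot>\<^bsub>P\<^esub> p i))"
      using ci m p g(1) h by (intro N.M.finsum_cong') (auto simp: semimodule_hom_def Pi_iff)
    also have "\<dots> = h (\<phi> c)"
      unfolding \<phi>_def using ci p
      by (intro semimodule_hom_finsum[OF P.left_semimodule_axioms N h, symmetric]) auto
    finally show ?thesis .
  qed
  show ?thesis
  proof (intro bexI ballI)
    show "(\<lambda>x. \<psi> (s x)) \<in> semimodule_hom S P M"
      using s \<psi> by (simp add: semimodule_hom_def Pi_iff)
    fix x assume x: "x \<in> carrier P"
    then have "s x \<in> carrier (free_semimodule S n)" using s by (auto simp: semimodule_hom_def)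
    with x show "g (\<psi> (s x)) = h x" by (simp add: g\<psi> \<phi>s)
  qed
qed

section \<open>Idempotent matrices\<close>

text \<open>An \<open>n \<times> n\<close> matrix is a function \<^typ>\<open>nat \<Rightarrow> nat \<Rightarrow> 'a\<close> read at indices below \<open>n\<close> only.\<close>

definition idempotent_matrix :: "'a ring \<Rightarrow> nat \<Rightarrow> (nat \<Rightarrow> nat \<Rightarrow> 'a) \<Rightarrow> bool"
  where "idempotent_matrix S n u \<longleftrightarrow>
    (\<forall>i<n. \<forall>j<n. u i j \<in> carrier S) \<and>
    (\<forall>i<n. \<forall>j<n. (\<Oplus>\<^bsub>S\<^esub>k\<in>{..<n}. u i k \<otimes>\<^bsub>S\<^esub> u k j) = u i j)"

definition row_semimodule :: "'a ring \<Rightarrow> nat \<Rightarrow> (nat \<Rightarrow> nat \<Rightarrow> 'a) \<Rightarrow> ('a, nat \<Rightarrow> 'a) module"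
  where "row_semimodule S n u =
    (free_semimodule S n)
      \<lparr>carrier := semimodule_span S (free_semimodule S n) ((\<lambda>i. \<lambda>j\<in>{..<n}. u i j) ` {..<n})\<rparr>"

section \<open>The monoid of isomorphism classes and the Grothendieck group\<close>

text \<open>
  An isomorphism class consists of semimodules over the type \<^typ>\<open>nat \<Rightarrow> 'a\<close>, but the
  representative \<open>P\<close> may live over any type. As every finitely generated projective semimodule
  is isomorphic to some \<open>S\<cdot>(u\<^sub>i\<^sub>j)\<close>, such a class is nonempty and determines \<open>P\<close> up to
  isomorphism.
\<close>

definition iso_class :: "'a ring \<Rightarrow> ('a, 'm) module \<Rightarrow> ('a, nat \<Rightarrow> 'a) module set"
  where "iso_class S P = {Q. fg_projective S Q \<and> semimodule_iso S P Q}"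

definition PF :: "'a ring \<Rightarrow> ('a, nat \<Rightarrow> 'a) module set monoid"
  where "PF S =
    \<lparr>carrier = {iso_class S P | P :: ('a, nat \<Rightarrow> 'a) module. fg_projective S P},
     monoid.mult = (\<lambda>p q. \<Union>P\<in>p. \<Union>Q\<in>q. iso_class S (direct_sum P Q)),
     one = iso_class S zero_semimodule\<rparr>"

definition K0_relations :: "'a ring \<Rightarrow> (('a, nat \<Rightarrow> 'a) module set \<Rightarrow>\<^sub>0 int) set"
  where "K0_relations S =
    generate (free_Abelian_group (carrier (PF S)))
      {frag_of p + frag_of q - frag_of (p \<otimes>\<^bsub>PF S\<^esub> q) | p q.
         p \<in> carrier (PF S) \<and> q \<in> carrier (PF S)}"

definition K0 :: "'a ring \<Rightarrow> (('a, nat \<Rightarrow> 'a) module set \<Rightarrow>\<^sub>0 int) set monoid"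
  where "K0 S = free_Abelian_group (carrier (PF S)) Mod K0_relations S"

definition K0_class ::
    "'a ring \<Rightarrow> ('a, nat \<Rightarrow> 'a) module set \<Rightarrow> (('a, nat \<Rightarrow> 'a) module set \<Rightarrow>\<^sub>0 int) set"
  where "K0_class S p = K0_relations S #>\<^bsub>free_Abelian_group (carrier (PF S))\<^esub> frag_of p"

definition PF_map ::
    "'a ring \<Rightarrow> 'b ring \<Rightarrow> ('a \<Rightarrow> 'b) \<Rightarrow>
      ('a, nat \<Rightarrow> 'a) module set \<Rightarrow> ('b, nat \<Rightarrow> 'b) module set"
  where "PF_map S T f p =
    (THE q. \<exists>n u. idempotent_matrix S n u \<and> p = iso_class S (row_semimodule S n u) \<and>
       q = iso_class T (row_semimodule T n (\<lambda>i j. f (u i j))))"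

definition K0_map ::
    "'a ring \<Rightarrow> 'b ring \<Rightarrow> ('a \<Rightarrow> 'b) \<Rightarrow>
      (('a, nat \<Rightarrow> 'a) module set \<Rightarrow>\<^sub>0 int) set \<Rightarrow> (('b, nat \<Rightarrow> 'b) module set \<Rightarrow>\<^sub>0 int) set"
  where "K0_map S T f =
    (THE \<phi>. \<phi> \<in> hom (K0 S) (K0 T) \<inter> extensional (carrier (K0 S)) \<and>
       (\<forall>p\<in>carrier (PF S). \<phi> (K0_class S p) = K0_class T (PF_map S T f p)))"

section \<open>Categories and functors\<close>

text \<open>Arrows are indexed by their domain and codomain, so hom-sets need not be disjoint.\<close>

record ('o, 'm) category =
  Obj :: "'o set"
  Hom :: "'o \<Rightarrow> 'o \<Rightarrow> 'm set"
  Id :: "'o \<Rightarrow> 'm"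
  Comp :: "'o \<Rightarrow> 'o \<Rightarrow> 'o \<Rightarrow> 'm \<Rightarrow> 'm \<Rightarrow> 'm"

locale category =
  fixes C :: "('o, 'm) category"
  assumes Id_in_Hom: "X \<in> Obj C \<Longrightarrow> Id C X \<in> Hom C X X"
    and Comp_in_Hom:
      "\<lbrakk>X \<in> Obj C; Y \<in> Obj C; Z \<in> Obj C; f \<in> Hom C X Y; g \<in> Hom C Y Z\<rbrakk> \<Longrightarrow>
        Comp C X Y Z g f \<in> Hom C X Z"
    and Comp_Id_right:
      "\<lbrakk>X \<in> Obj C; Y \<in> Obj C; f \<in> Hom C X Y\<rbrakk> \<Longrightarrow> Comp C X X Y f (Id C X) = f"
    and Comp_Id_left:
      "\<lbrakk>X \<in> Obj C; Y \<in> Obj C; f \<in> Hom C X Y\<rbrakk> \<Longrightarrow> Comp C X Y Y (Id C Y) f = f"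
    and Comp_assoc:
      "\<lbrakk>W \<in> Obj C; X \<in> Obj C; Y \<in> Obj C; Z \<in> Obj C;
        f \<in> Hom C W X; g \<in> Hom C X Y; h \<in> Hom C Y Z\<rbrakk> \<Longrightarrow>
        Comp C W Y Z h (Comp C W X Y g f) = Comp C W X Z (Comp C X Y Z h g) f"

locale category_functor = C: category C + D: category D
    for C :: "('o, 'm) category" and D :: "('p, 'n) category" +
  fixes F_obj :: "'o \<Rightarrow> 'p" and F_map :: "'o \<Rightarrow> 'o \<Rightarrow> 'm \<Rightarrow> 'n"
  assumes F_obj: "X \<in> Obj C \<Longrightarrow> F_obj X \<in> Obj D"
    and F_map:
      "\<lbrakk>X \<in> Obj C; Y \<in> Obj C; f \<in> Hom C X Y\<rbrakk> \<Longrightarrow> F_map X Y f \<in> Hom D (F_obj X) (F_obj Y)"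
    and F_Id: "X \<in> Obj C \<Longrightarrow> F_map X X (Id C X) = Id D (F_obj X)"
    and F_Comp:
      "\<lbrakk>X \<in> Obj C; Y \<in> Obj C; Z \<in> Obj C; f \<in> Hom C X Y; g \<in> Hom C Y Z\<rbrakk> \<Longrightarrow>
        F_map X Z (Comp C X Y Z g f) =
          Comp D (F_obj X) (F_obj Y) (F_obj Z) (F_map Y Z g) (F_map X Y f)"

text \<open>
  Arrows of the concrete categories are extensional functions, so that two arrows are
  equal as soon as they agree on the carrier of their domain.
\<close>

definition semiring_category :: "('a ring, 'a \<Rightarrow> 'a) category"
  where "semiring_category =
    \<lparr>Obj = {S. semiring S},
     Hom = (\<lambda>S T. semiring_hom S T \<inter> extensional (carrier S)),
     Id = (\<lambda>S. \<lambda>x\<in>carrier S. x),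
     Comp = (\<lambda>S _ _ g f. compose (carrier S) g f)\<rparr>"

definition abelian_group_category :: "('g monoid, 'g \<Rightarrow> 'g) category"
  where "abelian_group_category =
    \<lparr>Obj = {G. comm_group G},
     Hom = (\<lambda>G H. hom G H \<inter> extensional (carrier G)),
     Id = (\<lambda>G. \<lambda>x\<in>carrier G. x),
     Comp = (\<lambda>G _ _ g f. compose (carrier G) g f)\<rparr>"

end

theory Submission
  imports Defs
begin

text \<open>
  The whole difficulty is that \<^const>\<open>PF_map\<close> is prescribed on presentations: a class is written
  as \<open>[S\<cdot>u]\<close> for some idempotent matrix \<open>u\<close>, and its image has to depend on the class alone. Two
  facts make this work. Every finitely generated projective semimodule is some \<open>S\<cdot>u\<close>
  (\<open>fg_projective_iso_row\<close>: split a surjection \<open>S\<^sup>n \<rightarrow> P\<close> and take the matrix of the resulting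
  idempotent endomorphism of \<open>S\<^sup>n\<close>). And \<open>S\<cdot>u\<close> and \<open>S\<cdot>v\<close> are isomorphic exactly if there are
  rectangular matrices \<open>a\<close>, \<open>b\<close> with \<open>ab = u\<close> and \<open>ba = v\<close> (\<open>row_semimodule_iso_iff\<close>). The latter
  condition consists of equations between sums of products of entries, hence survives
  the application of a semiring homomorphism to all entries, and so \<open>PF_map_row\<close> holds.

  Since \<open>S\<cdot>u \<oplus> S\<cdot>v\<close> is isomorphic to the semimodule of the block diagonal matrix of \<open>u\<close> and \<open>v\<close>,
  and \<open>{0}\<close> to that of the \<open>0 \<times> 0\<close> matrix, both of which are compatible with entrywise maps,
  \<^const>\<open>PF_map\<close> is a monoid homomorphism; on matrices its functoriality is obvious.

  The passage to groups is formal: \<^const>\<open>K0_class\<close> is universal among the homomorphisms from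
  \<open>PF S\<close> to Abelian groups (\<open>K0_universal\<close> for existence, \<open>K0_hom_eqI\<close> for uniqueness), so that
  \<^const>\<open>K0_map\<close> exists, is determined by its values on classes, and inherits functoriality
  from \<^const>\<open>PF_map\<close>.
\<close>

section \<open>Isomorphisms of semimodules\<close>

lemma semimodule_homD:
  assumes "h \<in> semimodule_hom S M N"
  shows "x \<in> carrier M \<Longrightarrow> h x \<in> carrier N"
    and "h \<zero>\<^bsub>M\<^esub> = \<zero>\<^bsub>N\<^esub>"
    and "x \<in> carrier M \<Longrightarrow> y \<in> carrier M \<Longrightarrow> h (x \<oplus>\<^bsub>M\<^esub> y) = h x \<oplus>\<^bsub>N\<^esub> h y"
    and "a \<in> carrier S \<Longrightarrow> x \<in> carrier M \<Longrightarrow> h (a \<odot>\<^bsub>M\<^esub> x) = a \<odot>\<^bsub>N\<^esub> h x"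
  using assms by (auto simp: semimodule_hom_def)

lemma semimodule_homI:
  assumes "\<And>x. x \<in> carrier M \<Longrightarrow> h x \<in> carrier N"
    and "h \<zero>\<^bsub>M\<^esub> = \<zero>\<^bsub>N\<^esub>"
    and "\<And>x y. x \<in> carrier M \<Longrightarrow> y \<in> carrier M \<Longrightarrow> h (x \<oplus>\<^bsub>M\<^esub> y) = h x \<oplus>\<^bsub>N\<^esub> h y"
    and "\<And>a x. a \<in> carrier S \<Longrightarrow> x \<in> carrier M \<Longrightarrow> h (a \<odot>\<^bsub>M\<^esub> x) = a \<odot>\<^bsub>N\<^esub> h x"
  shows "h \<in> semimodule_hom S M N"
  using assms by (auto simp: semimodule_hom_def)

lemma semimodule_iso_refl: "semimodule_iso S M M"
  unfolding semimodule_iso_def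
  by (rule bexI[of _ id]) (auto intro: semimodule_homI)

lemma semimodule_iso_trans:
  assumes "semimodule_iso S M N" "semimodule_iso S N P"
  shows "semimodule_iso S M P"
proof -
  obtain g h where "g \<in> semimodule_hom S M N" "bij_betw g (carrier M) (carrier N)"
    "h \<in> semimodule_hom S N P" "bij_betw h (carrier N) (carrier P)"
    using assms unfolding semimodule_iso_def by blast
  then show ?thesis
    unfolding semimodule_iso_def
    by (intro bexI[of _ "h \<circ> g"] bij_betw_trans[of g])
      (auto intro!: semimodule_homI simp: semimodule_homD)
qed

lemma semimodule_hom_inv_into:
  assumes M: "left_semimodule S M"
    and h: "h \<in> semimodule_hom S M N" "bij_betw h (carrier M) (carrier N)"
  shows "inv_into (carrier M) h \<in> semimodule_hom S N M"
proof -
  interpret M: left_semimodule S M by fact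
  have inj: "inj_on h (carrier M)" and im: "carrier N = h ` carrier M"
    using h(2) by (auto simp: bij_betw_def)
  have eq: "inv_into (carrier M) h (h x) = x" if "x \<in> carrier M" for x
    using inj that by (rule inv_into_f_f)
  show ?thesis
  proof (rule semimodule_homI)
    show "inv_into (carrier M) h \<zero>\<^bsub>N\<^esub> = \<zero>\<^bsub>M\<^esub>"
      using eq[OF M.M.zero_closed] by (simp add: semimodule_homD(2)[OF h(1)])
  next
    fix x y assume "x \<in> carrier N" "y \<in> carrier N"
    then obtain x' y' where "x' \<in> carrier M" "x = h x'" "y' \<in> carrier M" "y = h y'"
      unfolding im by blast
    then show "inv_into (carrier M) h (x \<oplus>\<^bsub>N\<^esub> y) =
        inv_into (carrier M) h x \<oplus>\<^bsub>M\<^esub> inv_into (carrier M) h y"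
      by (simp add: eq flip: semimodule_homD(3)[OF h(1)])
  next
    fix a x assume "a \<in> carrier S" "x \<in> carrier N"
    moreover from this obtain x' where "x' \<in> carrier M" "x = h x'"
      unfolding im by blast
    ultimately show "inv_into (carrier M) h (a \<odot>\<^bsub>N\<^esub> x) = a \<odot>\<^bsub>M\<^esub> inv_into (carrier M) h x"
      by (simp add: eq flip: semimodule_homD(4)[OF h(1)])
  qed (simp add: im inv_into_into)
qed

lemma semimodule_iso_sym:
  assumes "left_semimodule S M" "semimodule_iso S M N"
  shows "semimodule_iso S N M"
  using assms semimodule_hom_inv_into bij_betw_inv_into unfolding semimodule_iso_def by blast

text \<open>
  The two representatives may live over different types; this is how the direct sum and the
  zero semimodule, which are not over \<^typ>\<open>nat \<Rightarrow> 'a\<close>, get replaced by row semimodules.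
\<close>

lemma iso_class_eqI:
  assumes "left_semimodule S P" "semimodule_iso S P Q"
  shows "iso_class S P = iso_class S Q"
proof -
  note iso = assms(2) semimodule_iso_sym[OF assms]
  show ?thesis
    unfolding iso_class_def
    using semimodule_iso_trans[OF iso(1)] semimodule_iso_trans[OF iso(2)] by blast
qed

lemma iso_class_eq_iff:
  fixes P Q :: "('a, nat \<Rightarrow> 'a) module"
  assumes "fg_projective S P" "fg_projective S Q"
  shows "iso_class S P = iso_class S Q \<longleftrightarrow> semimodule_iso S P Q"
proof
  have "Q \<in> iso_class S Q" using assms(2) by (simp add: iso_class_def semimodule_iso_refl)
  moreover assume "iso_class S P = iso_class S Q"
  ultimately show "semimodule_iso S P Q" by (auto simp: iso_class_def)
qed (use assms in \<open>simp add: fg_projective_def iso_class_eqI\<close>)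

section \<open>Row vectors and matrices\<close>

abbreviation matrix_over :: "'a ring \<Rightarrow> nat \<Rightarrow> nat \<Rightarrow> (nat \<Rightarrow> nat \<Rightarrow> 'a) \<Rightarrow> bool"
  where "matrix_over S n m a \<equiv> \<forall>i<n. \<forall>j<m. a i j \<in> carrier S"

definition matrix_row :: "nat \<Rightarrow> (nat \<Rightarrow> nat \<Rightarrow> 'a) \<Rightarrow> nat \<Rightarrow> nat \<Rightarrow> 'a"
  where "matrix_row m a i = (\<lambda>j\<in>{..<m}. a i j)"

definition row_times ::
    "'a ring \<Rightarrow> nat \<Rightarrow> nat \<Rightarrow> (nat \<Rightarrow> 'a) \<Rightarrow> (nat \<Rightarrow> nat \<Rightarrow> 'a) \<Rightarrow> nat \<Rightarrow> 'a"
  where "row_times S n m x a = (\<lambda>j\<in>{..<m}. \<Oplus>\<^bsub>S\<^esub>i\<in>{..<n}. x i \<otimes>\<^bsub>S\<^esub> a i j)"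

lemma carrier_free: "carrier (free_semimodule S n) = {..<n} \<rightarrow>\<^sub>E carrier S"
  by (simp add: free_semimodule_def)

lemma free_eqI:
  assumes "x \<in> carrier (free_semimodule S n)" "y \<in> carrier (free_semimodule S n)"
    "\<And>j. j < n \<Longrightarrow> x j = y j"
  shows "x = y"
  using assms by (auto simp: carrier_free intro: PiE_ext)

lemma matrix_row_closed:
  "matrix_over S n m a \<Longrightarrow> i < n \<Longrightarrow> matrix_row m a i \<in> carrier (free_semimodule S m)"
  by (simp add: matrix_row_def carrier_free)

lemma finsum_free_apply:
  assumes S: "semiring S" and "finite I" "y \<in> I \<rightarrow> carrier (free_semimodule S n)" "j < n"
  shows "(\<Oplus>\<^bsub>free_semimodule S n\<^esub>i\<in>I. y i) j = (\<Oplus>\<^bsub>S\<^esub>i\<in>I. y i j)"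
proof -
  interpret S: semiring S by fact
  interpret F: left_semimodule S "free_semimodule S n" by (rule left_semimodule_free[OF S])
  show ?thesis
    using assms(2,3)
  proof (induction I rule: finite_induct)
    case empty
    have "\<zero>\<^bsub>free_semimodule S n\<^esub> j = \<zero>\<^bsub>S\<^esub>"
      using \<open>j < n\<close> by (simp add: free_semimodule_def)
    then show ?case by simp
  next
    case (insert i I)
    then have "y i \<in> carrier (free_semimodule S n)" "y \<in> I \<rightarrow> carrier (free_semimodule S n)"
      by auto
    moreover from this have "y i j \<in> carrier S" "(\<lambda>i. y i j) \<in> I \<rightarrow> carrier S"
      using \<open>j < n\<close> by (auto simp: carrier_free)
    moreover have "(x \<oplus>\<^bsub>free_semimodule S n\<^esub> z) j = x j \<oplus>\<^bsub>S\<^esub> z j" for x z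
      using \<open>j < n\<close> by (simp add: free_semimodule_def)
    ultimately show ?case
      using insert by simp
  qed
qed

lemma row_times_closed:
  assumes "semiring S" "x \<in> carrier (free_semimodule S n)" "matrix_over S n m a"
  shows "row_times S n m x a \<in> carrier (free_semimodule S m)"
proof -
  interpret S: semiring S by fact
  show ?thesis
    using assms(2,3) by (auto simp: row_times_def carrier_free PiE_iff intro!: S.finsum_closed)
qed

text \<open>
  Reading \<open>xa\<close> as a linear combination of the rows of \<open>a\<close> makes it accessible to homomorphisms,
  which commute with linear combinations.
\<close>

lemma row_times_eq_finsum:
  assumes S: "semiring S" and x: "x \<in> carrier (free_semimodule S n)" and a: "matrix_over S n m a"
  shows "row_times S n m x a =
    (\<Oplus>\<^bsub>free_semimodule S m\<^esub>i\<in>{..<n}. x i \<odot>\<^bsub>free_semimodule S m\<^esub> matrix_row m a i)"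
proof -
  interpret S: semiring S by fact
  interpret F: left_semimodule S "free_semimodule S m" by (rule left_semimodule_free[OF S])
  have cl: "(\<lambda>i. x i \<odot>\<^bsub>free_semimodule S m\<^esub> matrix_row m a i)
      \<in> {..<n} \<rightarrow> carrier (free_semimodule S m)"
    using x matrix_row_closed[OF a] by (auto simp: carrier_free[of S n])
  show ?thesis
  proof (rule free_eqI[OF row_times_closed[OF S x a] F.M.finsum_closed[OF cl]])
    fix j assume j: "j < m"
    have "(\<Oplus>\<^bsub>S\<^esub>i\<in>{..<n}. x i \<otimes>\<^bsub>S\<^esub> a i j) =
        (\<Oplus>\<^bsub>S\<^esub>i\<in>{..<n}. (x i \<odot>\<^bsub>free_semimodule S m\<^esub> matrix_row m a i) j)"
      using j x a
      by (intro S.finsum_cong') (auto simp: free_semimodule_def matrix_row_def PiE_iff)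
    then show "row_times S n m x a j =
        (\<Oplus>\<^bsub>free_semimodule S m\<^esub>i\<in>{..<n}. x i \<odot>\<^bsub>free_semimodule S m\<^esub> matrix_row m a i) j"
      using j by (simp add: row_times_def finsum_free_apply[OF S _ cl])
  qed
qed

lemma row_times_hom:
  assumes S: "semiring S" and a: "matrix_over S n m a"
  shows "(\<lambda>x. row_times S n m x a) \<in> semimodule_hom S (free_semimodule S n) (free_semimodule S m)"
proof -
  interpret S: semiring S by fact
  interpret Fn: left_semimodule S "free_semimodule S n" by (rule left_semimodule_free[OF S])
  interpret Fm: left_semimodule S "free_semimodule S m" by (rule left_semimodule_free[OF S])
  let ?h = "\<lambda>c. \<Oplus>\<^bsub>free_semimodule S m\<^esub>i\<in>{..<n}. c i \<odot>\<^bsub>free_semimodule S m\<^esub> matrix_row m a i"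
  have h: "?h \<in> semimodule_hom S (free_semimodule S n) (free_semimodule S m)"
    by (rule Fm.linear_combination_hom) (use matrix_row_closed[OF a] in auto)
  have "row_times S n m x a = ?h x" if "x \<in> carrier (free_semimodule S n)" for x
    by (rule row_times_eq_finsum[OF S that a])
  with h show ?thesis
    by (intro semimodule_homI)
      (simp_all only: semimodule_homD[OF h] Fn.M.zero_closed Fn.M.add.m_closed Fn.smult_closed)
qed

lemma row_times_cong:
  assumes "semiring S" "x \<in> carrier (free_semimodule S n)" "matrix_over S n m b"
    and "\<And>i j. i < n \<Longrightarrow> j < m \<Longrightarrow> a i j = b i j"
  shows "row_times S n m x a = row_times S n m x b"
proof -
  interpret S: semiring S by fact
  show ?thesis
    unfolding row_times_def using assms(2-4)
    by (intro restrict_ext S.finsum_cong') (auto simp: carrier_free PiE_iff)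
qed

text \<open>
  Multiplication by \<open>b\<close> from the right is linear and thus can be applied to each row of \<open>a\<close> in the
  linear combination \<open>xa\<close>. The matrix on the right-hand side is the product \<open>ab\<close>, given by its rows.
\<close>

lemma row_times_assoc:
  assumes S: "semiring S" and x: "x \<in> carrier (free_semimodule S n)"
    and a: "matrix_over S n m a" and b: "matrix_over S m k b"
  shows "row_times S m k (row_times S n m x a) b =
    row_times S n k x (\<lambda>i. row_times S m k (matrix_row m a i) b)"
proof -
  interpret S: semiring S by fact
  interpret Fm: left_semimodule S "free_semimodule S m" by (rule left_semimodule_free[OF S])
  interpret Fk: left_semimodule S "free_semimodule S k" by (rule left_semimodule_free[OF S])
  note h = row_times_hom[OF S b]
  note r = matrix_row_closed[OF a]
  have xi: "x i \<in> carrier S" if "i < n" for i using x that by (auto simp: carrier_free)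
  let ?c = "\<lambda>i. row_times S m k (matrix_row m a i) b"
  have c: "?c i \<in> carrier (free_semimodule S k)" if "i < n" for i
    using r[OF that] by (rule semimodule_homD(1)[OF h])
  then have c': "matrix_over S n k ?c" by (auto simp: carrier_free PiE_iff)
  have c'': "matrix_row k ?c i = ?c i" if "i < n" for i
    by (simp add: matrix_row_def row_times_def restrict_def cong: if_cong)
  have "row_times S m k (row_times S n m x a) b =
      (\<Oplus>\<^bsub>free_semimodule S k\<^esub>i\<in>{..<n}.
         row_times S m k (x i \<odot>\<^bsub>free_semimodule S m\<^esub> matrix_row m a i) b)"
    unfolding row_times_eq_finsum[OF S x a]
    by (rule semimodule_hom_finsum[OF left_semimodule_free[OF S] left_semimodule_free[OF S] h])
      (use xi r in auto)
  also have "\<dots> =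
      (\<Oplus>\<^bsub>free_semimodule S k\<^esub>i\<in>{..<n}. x i \<odot>\<^bsub>free_semimodule S k\<^esub> matrix_row k ?c i)"
    using xi r c by (intro Fk.M.finsum_cong') (auto simp: c'' semimodule_homD(4)[OF h])
  also have "\<dots> = row_times S n k x ?c"
    by (rule row_times_eq_finsum[OF S x c', symmetric])
  finally show ?thesis .
qed

section \<open>Row semimodules of idempotent matrices\<close>

lemma idempotent_matrix_over: "idempotent_matrix S n u \<Longrightarrow> matrix_over S n n u"
  by (simp add: idempotent_matrix_def)

lemma carrier_row_semimodule_span:
  "carrier (row_semimodule S n u) =
     semimodule_span S (free_semimodule S n) (matrix_row n u ` {..<n})"
  by (simp add: row_semimodule_def matrix_row_def)

lemma row_semimodule_simps:
  "\<zero>\<^bsub>row_semimodule S n u\<^esub> = \<zero>\<^bsub>free_semimodule S n\<^esub>"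
  "x \<oplus>\<^bsub>row_semimodule S n u\<^esub> y = x \<oplus>\<^bsub>free_semimodule S n\<^esub> y"
  "a \<odot>\<^bsub>row_semimodule S n u\<^esub> x = a \<odot>\<^bsub>free_semimodule S n\<^esub> x"
  by (simp_all add: row_semimodule_def)

lemma row_times_idempotent_row:
  assumes S: "semiring S" and u: "idempotent_matrix S n u" and i: "i < n"
  shows "row_times S n n (matrix_row n u i) u = matrix_row n u i"
proof -
  interpret S: semiring S by fact
  have eq: "(\<Oplus>\<^bsub>S\<^esub>k\<in>{..<n}. matrix_row n u i k \<otimes>\<^bsub>S\<^esub> u k j) = u i j" if "j < n" for j
  proof -
    have "(\<Oplus>\<^bsub>S\<^esub>k\<in>{..<n}. matrix_row n u i k \<otimes>\<^bsub>S\<^esub> u k j) = (\<Oplus>\<^bsub>S\<^esub>k\<in>{..<n}. u i k \<otimes>\<^bsub>S\<^esub> u k j)"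
      using idempotent_matrix_over[OF u] i that
      by (intro S.finsum_cong') (auto simp: matrix_row_def)
    then show ?thesis using u i that by (simp add: idempotent_matrix_def)
  qed
  show ?thesis
    unfolding row_times_def by (subst (2) matrix_row_def) (intro restrict_ext, use eq in simp)
qed

lemma subsemimodule_finsum:
  assumes "left_semimodule S M" "subsemimodule S M A" "finite I" "y \<in> I \<rightarrow> A"
  shows "(\<Oplus>\<^bsub>M\<^esub>i\<in>I. y i) \<in> A"
proof -
  interpret M: left_semimodule S M by fact
  have A: "A \<subseteq> carrier M" using assms(2) by (simp add: subsemimodule_def)
  show ?thesis
    using assms(3,4)
  proof (induction I rule: finite_induct)
    case empty
    then show ?case using assms(2) by (simp add: subsemimodule_def)
  next
    case (insert i I)
    then have "y i \<in> A" "y \<in> I \<rightarrow> A" by auto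
    moreover from this have "y i \<in> carrier M" "y \<in> I \<rightarrow> carrier M" using A by auto
    ultimately show ?case
      using insert assms(2) by (simp add: subsemimodule_def)
  qed
qed

text \<open>
  The vectors fixed by \<open>u\<close> form a subsemimodule, which contains the rows of \<open>u\<close> by idempotence;
  conversely a fixed \<open>x = xu\<close> is a linear combination of these rows.
\<close>

lemma carrier_row_semimodule:
  assumes S: "semiring S" and u: "idempotent_matrix S n u"
  shows "carrier (row_semimodule S n u) =
    {x \<in> carrier (free_semimodule S n). row_times S n n x u = x}" (is "_ = ?A")
proof -
  interpret F: left_semimodule S "free_semimodule S n" by (rule left_semimodule_free[OF S])
  note over = idempotent_matrix_over[OF u]
  note h = row_times_hom[OF S over]
  have "subsemimodule S (free_semimodule S n) ?A"
    unfolding subsemimodule_def using semimodule_homD(2-4)[OF h] by auto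
  moreover have "matrix_row n u ` {..<n} \<subseteq> ?A"
    using matrix_row_closed[OF over] row_times_idempotent_row[OF S u] by auto
  moreover have "?A \<subseteq> B"
    if B: "subsemimodule S (free_semimodule S n) B" "matrix_row n u ` {..<n} \<subseteq> B" for B
  proof
    fix x assume x: "x \<in> ?A"
    then have "(\<lambda>i. x i \<odot>\<^bsub>free_semimodule S n\<^esub> matrix_row n u i) \<in> {..<n} \<rightarrow> B"
      using B by (auto simp: carrier_free[of S n] subsemimodule_def PiE_iff image_subset_iff)
    then have "(\<Oplus>\<^bsub>free_semimodule S n\<^esub>i\<in>{..<n}.
        x i \<odot>\<^bsub>free_semimodule S n\<^esub> matrix_row n u i) \<in> B"
      by (intro subsemimodule_finsum[OF left_semimodule_free[OF S] B(1)]) auto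
    moreover from x have "x \<in> carrier (free_semimodule S n)" and "row_times S n n x u = x" by auto
    ultimately show "x \<in> B" using row_times_eq_finsum[OF S _ over] by metis
  qed
  ultimately show ?thesis
    unfolding carrier_row_semimodule_span semimodule_span_def by blast
qed

lemma matrix_row_in_row_semimodule:
  assumes "semiring S" "idempotent_matrix S n u" "i < n"
  shows "matrix_row n u i \<in> carrier (row_semimodule S n u)"
  using assms matrix_row_closed[OF idempotent_matrix_over]
  by (simp add: carrier_row_semimodule row_times_idempotent_row)

lemma left_semimodule_row:
  assumes S: "semiring S" and u: "idempotent_matrix S n u"
  shows "left_semimodule S (row_semimodule S n u)"
proof -
  interpret S: semiring S by fact
  interpret F: left_semimodule S "free_semimodule S n" by (rule left_semimodule_free[OF S])
  note h = row_times_hom[OF S idempotent_matrix_over[OF u]]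
  note simps = carrier_row_semimodule[OF S u] row_semimodule_simps
  have "abelian_monoid (row_semimodule S n u)"
    by (rule abelian_monoidI)
      (auto simp: simps semimodule_homD[OF h] F.M.a_ac)
  then interpret R: abelian_monoid "row_semimodule S n u" .
  show ?thesis
    by unfold_locales
      (auto simp: simps semimodule_homD[OF h] F.smult_assoc F.smult_l_distr F.smult_r_distr)
qed

lemma row_semimodule_hom_free:
  assumes "semiring S" "idempotent_matrix S n u"
  shows "(\<lambda>x. x) \<in> semimodule_hom S (row_semimodule S n u) (free_semimodule S n)"
  using assms by (intro semimodule_homI) (auto simp: row_semimodule_simps carrier_row_semimodule)

text \<open>
  As \<open>x = xu\<close>, the vector \<open>x\<close> is itself the linear combination of the rows of \<open>u\<close> with its own
  entries as coefficients, although the rows need not be linearly independent.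
\<close>

lemma row_semimodule_hom_eq:
  assumes S: "semiring S" and u: "idempotent_matrix S n u" and N: "left_semimodule S N"
    and h: "h \<in> semimodule_hom S (row_semimodule S n u) N"
    and x: "x \<in> carrier (row_semimodule S n u)"
  shows "h x = (\<Oplus>\<^bsub>N\<^esub>i\<in>{..<n}. x i \<odot>\<^bsub>N\<^esub> h (matrix_row n u i))"
proof -
  interpret N: left_semimodule S N by fact
  note R = left_semimodule_row[OF S u]
  interpret R: left_semimodule S "row_semimodule S n u" by (rule R)
  have xF: "x \<in> carrier (free_semimodule S n)" and fixed: "row_times S n n x u = x"
    using x by (simp_all add: carrier_row_semimodule[OF S u])
  have xi: "x i \<in> carrier S" if "i < n" for i using xF that by (auto simp: carrier_free)
  note rows = matrix_row_in_row_semimodule[OF S u]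
  let ?y = "\<lambda>i. x i \<odot>\<^bsub>row_semimodule S n u\<^esub> matrix_row n u i"
  have y: "?y \<in> {..<n} \<rightarrow> carrier (row_semimodule S n u)" using xi rows by auto
  have "x = (\<Oplus>\<^bsub>free_semimodule S n\<^esub>i\<in>{..<n}. ?y i)"
    using row_times_eq_finsum[OF S xF idempotent_matrix_over[OF u]] fixed
    by (simp add: row_semimodule_simps)
  \<comment> \<open>finite sums depend on the carrier of the structure, so the sum is moved along the inclusion\<close>
  also have "\<dots> = (\<Oplus>\<^bsub>row_semimodule S n u\<^esub>i\<in>{..<n}. ?y i)"
    by (rule semimodule_hom_finsum[OF R left_semimodule_free[OF S]
          row_semimodule_hom_free[OF S u] _ y, symmetric]) simp
  finally have "h x = h (\<Oplus>\<^bsub>row_semimodule S n u\<^esub>i\<in>{..<n}. ?y i)" by (rule arg_cong)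
  also have "\<dots> = (\<Oplus>\<^bsub>N\<^esub>i\<in>{..<n}. h (?y i))"
    by (rule semimodule_hom_finsum[OF R N h _ y]) simp
  also have "\<dots> = (\<Oplus>\<^bsub>N\<^esub>i\<in>{..<n}. x i \<odot>\<^bsub>N\<^esub> h (matrix_row n u i))"
    using xi rows semimodule_homD[OF h] by (intro N.M.finsum_cong') auto
  finally show ?thesis .
qed

text \<open>
  The semimodule is generated by the rows of \<open>u\<close>. To lift a homomorphism \<open>h\<close> along \<open>g\<close>, choose
  preimages under \<open>g\<close> of the values of \<open>h\<close> at the rows, extend linearly to \<open>S\<^sup>n\<close>, and restrict.
\<close>

lemma fg_projective_row:
  assumes S: "semiring S" and u: "idempotent_matrix S n u"
  shows "fg_projective S (row_semimodule S n u)"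
proof -
  let ?R = "row_semimodule S n u" and ?F = "free_semimodule S n"
  note R = left_semimodule_row[OF S u]
  note rows = matrix_row_in_row_semimodule[OF S u]
  have "semimodule_span S ?R (matrix_row n u ` {..<n}) = carrier ?R"
  proof
    have "subsemimodule S ?R (carrier ?R)"
    proof -
      interpret R: left_semimodule S ?R by (rule R)
      show ?thesis by (simp add: subsemimodule_def)
    qed
    with rows show "semimodule_span S ?R (matrix_row n u ` {..<n}) \<subseteq> carrier ?R"
      unfolding semimodule_span_def by auto
    have "subsemimodule S ?F A" if "subsemimodule S ?R A" for A
      using that carrier_row_semimodule[OF S u] by (auto simp: subsemimodule_def row_semimodule_simps)
    then show "carrier ?R \<subseteq> semimodule_span S ?R (matrix_row n u ` {..<n})"
      unfolding carrier_row_semimodule_span[of S n u] semimodule_span_def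
      by (intro Inter_anti_mono) auto
  qed
  then have fg: "finitely_generated S ?R"
    unfolding finitely_generated_def using rows by (intro exI[of _ "matrix_row n u ` {..<n}"]) auto
  have "projective S ?R"
    unfolding projective_def
  proof (intro allI impI)
    fix M N :: "('a, nat \<Rightarrow> 'a) module" and g h
    assume M: "left_semimodule S M" and N: "left_semimodule S N"
      and g: "g \<in> semimodule_hom S M N" "g ` carrier M = carrier N"
      and h: "h \<in> semimodule_hom S ?R N"
    interpret M: left_semimodule S M by (rule M)
    interpret N: left_semimodule S N by (rule N)
    define m where "m = (\<lambda>i. inv_into (carrier M) g (h (matrix_row n u i)))"
    have "h (matrix_row n u i) \<in> g ` carrier M" if "i < n" for i
      using semimodule_homD(1)[OF h rows[OF that]] g(2) by simp
    then have m: "m i \<in> carrier M" and gm: "g (m i) = h (matrix_row n u i)" if "i < n" for i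
      unfolding m_def using that by (simp_all add: inv_into_into f_inv_into_f)
    let ?l = "\<lambda>c. \<Oplus>\<^bsub>M\<^esub>i\<in>{..<n}. c i \<odot>\<^bsub>M\<^esub> m i"
    have "?l \<in> semimodule_hom S ?F M"
      by (rule M.linear_combination_hom) (use m in auto)
    then have l: "?l \<in> semimodule_hom S ?R M"
      using carrier_row_semimodule[OF S u]
      by (auto simp: semimodule_hom_def row_semimodule_simps)
    have "g (?l x) = h x" if x: "x \<in> carrier ?R" for x
    proof -
      have xi: "x i \<in> carrier S" if "i < n" for i
        using x that by (auto simp: carrier_row_semimodule[OF S u] carrier_free)
      have "g (?l x) = (\<Oplus>\<^bsub>N\<^esub>i\<in>{..<n}. g (x i \<odot>\<^bsub>M\<^esub> m i))"
        by (rule semimodule_hom_finsum[OF M N g(1)]) (use xi m in auto)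
      also have "\<dots> = (\<Oplus>\<^bsub>N\<^esub>i\<in>{..<n}. x i \<odot>\<^bsub>N\<^esub> h (matrix_row n u i))"
        using xi m semimodule_homD(1)[OF h rows]
        by (intro N.M.finsum_cong') (auto simp: semimodule_homD(4)[OF g(1)] gm)
      also have "\<dots> = h x"
        by (rule row_semimodule_hom_eq[OF S u N h x, symmetric])
      finally show ?thesis .
    qed
    with l show "\<exists>h'\<in>semimodule_hom S ?R M. \<forall>x\<in>carrier ?R. g (h' x) = h x"
      by (intro bexI ballI)
  qed
  with R fg show ?thesis by (simp add: fg_projective_def)
qed

text \<open>
  Projectivity splits a surjection \<open>\<phi> : S\<^sup>n \<rightarrow> P\<close> by some \<open>s\<close>. The endomorphism \<open>s \<circ> \<phi>\<close> of \<open>S\<^sup>n\<close> is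
  idempotent, hence so is its matrix, whose rows are the images under \<open>s\<close> of the generators.
  Its fixed vectors are the range of \<open>s\<close>, which is a copy of \<open>P\<close>.
\<close>

lemma fg_projective_iso_row:
  assumes S: "semiring S" and P: "fg_projective S P"
  obtains n u where "idempotent_matrix S n u" "semimodule_iso S P (row_semimodule S n u)"
proof -
  have lP: "left_semimodule S P" using P by (simp add: fg_projective_def)
  interpret P: left_semimodule S P by (rule lP)
  obtain n p where p: "p \<in> {..<n} \<rightarrow> carrier P"
    and surj: "(\<lambda>c. \<Oplus>\<^bsub>P\<^esub>i\<in>{..<n}. c i \<odot>\<^bsub>P\<^esub> p i) ` carrier (free_semimodule S n) = carrier P"
    by (rule finitely_generated_imp_quotient[of S P]) (use P in \<open>auto simp: fg_projective_def\<close>)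
  define \<phi> where "\<phi> = (\<lambda>c. \<Oplus>\<^bsub>P\<^esub>i\<in>{..<n}. c i \<odot>\<^bsub>P\<^esub> p i)"
  let ?F = "free_semimodule S n"
  have \<phi>: "\<phi> \<in> semimodule_hom S ?F P" "\<phi> ` carrier ?F = carrier P"
    using P.linear_combination_hom[OF p] surj by (simp_all add: \<phi>_def)
  have "(\<lambda>x. x) \<in> semimodule_hom S P P" by (rule semimodule_homI) auto
  from fg_projective_lifts[OF P left_semimodule_free[OF S] lP \<phi> this]
  obtain s where s: "s \<in> semimodule_hom S P ?F" and \<phi>s: "\<And>x. x \<in> carrier P \<Longrightarrow> \<phi> (s x) = x"
    by blast
  define u where "u = (\<lambda>i. s (p i))"
  have sp: "s (p i) \<in> carrier ?F" if "i < n" for i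
    using p that semimodule_homD(1)[OF s] by auto
  then have over: "matrix_over S n n u" by (auto simp: u_def carrier_free)
  have row: "matrix_row n u i = s (p i)" if "i < n" for i
    using sp[OF that] by (simp add: matrix_row_def u_def carrier_free PiE_def extensional_restrict)
  have times: "row_times S n n x u = s (\<phi> x)" if x: "x \<in> carrier ?F" for x
  proof -
    interpret F: left_semimodule S ?F by (rule left_semimodule_free[OF S])
    have xi: "x i \<in> carrier S" if "i < n" for i using x that by (auto simp: carrier_free)
    have "s (\<phi> x) = (\<Oplus>\<^bsub>?F\<^esub>i\<in>{..<n}. s (x i \<odot>\<^bsub>P\<^esub> p i))"
      unfolding \<phi>_def
      by (rule semimodule_hom_finsum[OF lP left_semimodule_free[OF S] s]) (use xi p in auto)
    also have "\<dots> = (\<Oplus>\<^bsub>?F\<^esub>i\<in>{..<n}. x i \<odot>\<^bsub>?F\<^esub> matrix_row n u i)"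
      using xi p sp by (intro F.M.finsum_cong') (auto simp: row semimodule_homD(4)[OF s] Pi_iff)
    finally show ?thesis by (simp add: row_times_eq_finsum[OF S x over])
  qed
  have idem: "idempotent_matrix S n u"
    unfolding idempotent_matrix_def
  proof (intro conjI allI impI)
    fix i j assume ij: "i < n" "j < n"
    have "row_times S n n (u i) u = u i"
      using times[OF sp[OF ij(1)]] p ij(1) by (simp add: \<phi>s Pi_iff u_def)
    then have "row_times S n n (u i) u j = u i j" by simp
    then show "(\<Oplus>\<^bsub>S\<^esub>k\<in>{..<n}. u i k \<otimes>\<^bsub>S\<^esub> u k j) = u i j"
      using ij by (simp add: row_times_def)
  qed (use over in auto)
  have carrier: "carrier (row_semimodule S n u) = s ` carrier P"
  proof (intro equalityI subsetI)
    fix x assume "x \<in> carrier (row_semimodule S n u)"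
    then have x: "x \<in> carrier ?F" "s (\<phi> x) = x"
      by (auto simp: carrier_row_semimodule[OF S idem] times)
    with semimodule_homD(1)[OF \<phi>(1) x(1)] show "x \<in> s ` carrier P" by (metis image_eqI)
  next
    fix x assume "x \<in> s ` carrier P"
    then show "x \<in> carrier (row_semimodule S n u)"
      using \<phi>s semimodule_homD(1)[OF s] by (auto simp: carrier_row_semimodule[OF S idem] times)
  qed
  have "s \<in> semimodule_hom S P (row_semimodule S n u)"
    by (rule semimodule_homI) (auto simp: carrier row_semimodule_simps semimodule_homD[OF s])
  moreover have "bij_betw s (carrier P) (carrier (row_semimodule S n u))"
    unfolding bij_betw_def carrier by (metis \<phi>s inj_on_def)
  ultimately show thesis
    using that[OF idem] unfolding semimodule_iso_def by blast
qed

section \<open>Equivalent idempotents\<close>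

text \<open>
  This is Murray-von Neumann equivalence: \<open>u = ab\<close> and \<open>v = ba\<close>. It is stated through the entries
  in order that it can be mapped entrywise.
\<close>

definition equivalent_idempotents ::
    "'a ring \<Rightarrow> nat \<Rightarrow> (nat \<Rightarrow> nat \<Rightarrow> 'a) \<Rightarrow> nat \<Rightarrow> (nat \<Rightarrow> nat \<Rightarrow> 'a) \<Rightarrow> bool"
  where "equivalent_idempotents S n u m v \<longleftrightarrow>
    (\<exists>a b. matrix_over S n m a \<and> matrix_over S m n b \<and>
       (\<forall>i<n. \<forall>k<n. (\<Oplus>\<^bsub>S\<^esub>j\<in>{..<m}. a i j \<otimes>\<^bsub>S\<^esub> b j k) = u i k) \<and>
       (\<forall>i<m. \<forall>k<m. (\<Oplus>\<^bsub>S\<^esub>j\<in>{..<n}. b i j \<otimes>\<^bsub>S\<^esub> a j k) = v i k))"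

lemma row_times_product_eq:
  assumes S: "semiring S" and x: "x \<in> carrier (free_semimodule S n)"
    and a: "matrix_over S n m a" and b: "matrix_over S m k b" and c: "matrix_over S n k c"
    and ab: "\<forall>i<n. \<forall>l<k. (\<Oplus>\<^bsub>S\<^esub>j\<in>{..<m}. a i j \<otimes>\<^bsub>S\<^esub> b j l) = c i l"
  shows "row_times S m k (row_times S n m x a) b = row_times S n k x c"
proof -
  interpret S: semiring S by fact
  have "row_times S m k (matrix_row m a i) b l = c i l" if "i < n" "l < k" for i l
  proof -
    have "(\<Oplus>\<^bsub>S\<^esub>j\<in>{..<m}. matrix_row m a i j \<otimes>\<^bsub>S\<^esub> b j l) = (\<Oplus>\<^bsub>S\<^esub>j\<in>{..<m}. a i j \<otimes>\<^bsub>S\<^esub> b j l)"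
      using a b that by (intro S.finsum_cong') (auto simp: matrix_row_def)
    then show ?thesis using ab that by (simp add: row_times_def)
  qed
  then show ?thesis
    unfolding row_times_assoc[OF S x a b] by (rule row_times_cong[OF S x c])
qed

text \<open>
  If \<open>ab = u\<close> and \<open>ba = v\<close> then multiplication by \<open>a\<close> maps \<open>S\<cdot>u\<close> into \<open>S\<cdot>v\<close> because
  \<open>xav = xaba = xua = xa\<close>, and multiplication by \<open>b\<close> undoes it because \<open>xab = xu = x\<close>.
\<close>

lemma row_times_into_row_semimodule:
  assumes S: "semiring S" and u: "idempotent_matrix S n u" and v: "idempotent_matrix S m v"
    and a: "matrix_over S n m a" and b: "matrix_over S m n b"
    and ab: "\<forall>i<n. \<forall>k<n. (\<Oplus>\<^bsub>S\<^esub>j\<in>{..<m}. a i j \<otimes>\<^bsub>S\<^esub> b j k) = u i k"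
    and ba: "\<forall>i<m. \<forall>k<m. (\<Oplus>\<^bsub>S\<^esub>j\<in>{..<n}. b i j \<otimes>\<^bsub>S\<^esub> a j k) = v i k"
    and x: "x \<in> carrier (row_semimodule S n u)"
  shows "row_times S n m x a \<in> carrier (row_semimodule S m v)"
    and "row_times S m n (row_times S n m x a) b = x"
proof -
  have xF: "x \<in> carrier (free_semimodule S n)" and fixed: "row_times S n n x u = x"
    using x by (simp_all add: carrier_row_semimodule[OF S u])
  note y = row_times_closed[OF S xF a]
  show retract: "row_times S m n (row_times S n m x a) b = x"
    using row_times_product_eq[OF S xF a b idempotent_matrix_over[OF u] ab] fixed by simp
  have "row_times S m m (row_times S n m x a) v = row_times S n m x a"
    using row_times_product_eq[OF S y b a idempotent_matrix_over[OF v] ba] retract by simp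
  with y show "row_times S n m x a \<in> carrier (row_semimodule S m v)"
    by (simp add: carrier_row_semimodule[OF S v])
qed

text \<open>
  This is \<open>row_semimodule_hom_eq\<close> read in \<open>S\<^sup>m\<close>, where a linear combination of given vectors is
  multiplication by the matrix with these rows.
\<close>

lemma row_hom_as_matrix:
  assumes S: "semiring S" and u: "idempotent_matrix S n u" and v: "idempotent_matrix S m v"
    and h: "h \<in> semimodule_hom S (row_semimodule S n u) (row_semimodule S m v)"
  shows "matrix_over S n m (\<lambda>i. h (matrix_row n u i))"
    and "x \<in> carrier (row_semimodule S n u) \<Longrightarrow>
      h x = row_times S n m x (\<lambda>i. h (matrix_row n u i))"
proof -
  let ?a = "\<lambda>i. h (matrix_row n u i)"
  have ai: "?a i \<in> carrier (free_semimodule S m)" if "i < n" for i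
    using semimodule_homD(1)[OF h matrix_row_in_row_semimodule[OF S u that]]
    by (simp add: carrier_row_semimodule[OF S v])
  then show over: "matrix_over S n m ?a" by (auto simp: carrier_free)
  have row: "matrix_row m ?a i = ?a i" if "i < n" for i
    using ai[OF that] by (simp add: matrix_row_def carrier_free PiE_def extensional_restrict)
  assume x: "x \<in> carrier (row_semimodule S n u)"
  then have xF: "x \<in> carrier (free_semimodule S n)"
    by (simp add: carrier_row_semimodule[OF S u])
  then have xi: "x i \<in> carrier S" if "i < n" for i using that by (auto simp: carrier_free)
  interpret F: left_semimodule S "free_semimodule S m" by (rule left_semimodule_free[OF S])
  have hF: "h \<in> semimodule_hom S (row_semimodule S n u) (free_semimodule S m)"
    using h by (auto simp: semimodule_hom_def row_semimodule_simps carrier_row_semimodule[OF S v])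
  have "h x = (\<Oplus>\<^bsub>free_semimodule S m\<^esub>i\<in>{..<n}. x i \<odot>\<^bsub>free_semimodule S m\<^esub> ?a i)"
    by (rule row_semimodule_hom_eq[OF S u left_semimodule_free[OF S] hF x])
  also have "\<dots> = (\<Oplus>\<^bsub>free_semimodule S m\<^esub>i\<in>{..<n}. x i \<odot>\<^bsub>free_semimodule S m\<^esub> matrix_row m ?a i)"
    using xi ai by (intro F.M.finsum_cong') (auto simp: row)
  finally show "h x = row_times S n m x ?a"
    by (simp only: row_times_eq_finsum[OF S xF over])
qed

text \<open>
  Given an isomorphism \<open>h\<close>, the matrices \<open>a\<close> of \<open>h\<close> and \<open>b\<close> of its inverse do it: the \<open>i\<close>-th row of
  \<open>ab\<close> is the image under the inverse of the \<open>i\<close>-th row \<open>h(u\<^sub>i)\<close> of \<open>a\<close>, which is \<open>u\<^sub>i\<close>.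
\<close>

lemma row_semimodule_iso_iff:
  assumes S: "semiring S" and u: "idempotent_matrix S n u" and v: "idempotent_matrix S m v"
  shows "semimodule_iso S (row_semimodule S n u) (row_semimodule S m v) \<longleftrightarrow>
    equivalent_idempotents S n u m v"
proof
  assume "semimodule_iso S (row_semimodule S n u) (row_semimodule S m v)"
  then obtain h where h: "h \<in> semimodule_hom S (row_semimodule S n u) (row_semimodule S m v)"
    and bij: "bij_betw h (carrier (row_semimodule S n u)) (carrier (row_semimodule S m v))"
    unfolding semimodule_iso_def by blast
  define h' where "h' = inv_into (carrier (row_semimodule S n u)) h"
  have h': "h' \<in> semimodule_hom S (row_semimodule S m v) (row_semimodule S n u)"
    unfolding h'_def by (rule semimodule_hom_inv_into[OF left_semimodule_row[OF S u] h bij])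
  have inv: "h' (h x) = x" if "x \<in> carrier (row_semimodule S n u)" for x
    unfolding h'_def by (rule bij_betw_inv_into_left[OF bij that])
  have inv': "h (h' y) = y" if "y \<in> carrier (row_semimodule S m v)" for y
    unfolding h'_def by (rule bij_betw_inv_into_right[OF bij that])
  define a where "a = (\<lambda>i. h (matrix_row n u i))"
  define b where "b = (\<lambda>j. h' (matrix_row m v j))"
  note a = row_hom_as_matrix[OF S u v h, folded a_def]
  note b = row_hom_as_matrix[OF S v u h', folded b_def]
  note rows = matrix_row_in_row_semimodule[OF S]
  have "(\<Oplus>\<^bsub>S\<^esub>j\<in>{..<m}. a i j \<otimes>\<^bsub>S\<^esub> b j k) = u i k" if ik: "i < n" "k < n" for i k
  proof -
    have "row_times S m n (a i) b = matrix_row n u i"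
      using b(2)[OF semimodule_homD(1)[OF h rows[OF u ik(1)]]] inv[OF rows[OF u ik(1)]]
      by (simp add: a_def)
    then have "row_times S m n (a i) b k = matrix_row n u i k" by simp
    then show ?thesis using ik by (simp add: row_times_def matrix_row_def)
  qed
  moreover have "(\<Oplus>\<^bsub>S\<^esub>j\<in>{..<n}. b i j \<otimes>\<^bsub>S\<^esub> a j k) = v i k" if ik: "i < m" "k < m" for i k
  proof -
    have "row_times S n m (b i) a = matrix_row m v i"
      using a(2)[OF semimodule_homD(1)[OF h' rows[OF v ik(1)]]] inv'[OF rows[OF v ik(1)]]
      by (simp add: b_def)
    then have "row_times S n m (b i) a k = matrix_row m v i k" by simp
    then show ?thesis using ik by (simp add: row_times_def matrix_row_def)
  qed
  ultimately show "equivalent_idempotents S n u m v"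
    unfolding equivalent_idempotents_def using a(1) b(1)
    by (intro exI[of _ a] exI[of _ b]) (simp add: a_def b_def)
next
  assume "equivalent_idempotents S n u m v"
  then obtain a b where a: "matrix_over S n m a" and b: "matrix_over S m n b"
    and ab: "\<forall>i<n. \<forall>k<n. (\<Oplus>\<^bsub>S\<^esub>j\<in>{..<m}. a i j \<otimes>\<^bsub>S\<^esub> b j k) = u i k"
    and ba: "\<forall>i<m. \<forall>k<m. (\<Oplus>\<^bsub>S\<^esub>j\<in>{..<n}. b i j \<otimes>\<^bsub>S\<^esub> a j k) = v i k"
    unfolding equivalent_idempotents_def by (elim exE conjE) (rule that)
  note there = row_times_into_row_semimodule[OF S u v a b ab ba]
  note return = row_times_into_row_semimodule[OF S v u b a ba ab]
  have "(\<lambda>x. row_times S n m x a) \<in> semimodule_hom S (row_semimodule S n u) (row_semimodule S m v)"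
    using there(1) semimodule_homD(2-4)[OF row_times_hom[OF S a]]
    by (intro semimodule_homI) (simp_all add: row_semimodule_simps carrier_row_semimodule[OF S u])
  moreover have "bij_betw (\<lambda>x. row_times S n m x a)
      (carrier (row_semimodule S n u)) (carrier (row_semimodule S m v))"
    by (rule bij_betw_byWitness[where f' = "\<lambda>y. row_times S m n y b"])
      (assumption | rule ballI image_subsetI there return)+
  ultimately show "semimodule_iso S (row_semimodule S n u) (row_semimodule S m v)"
    unfolding semimodule_iso_def by (intro bexI)
qed

section \<open>Change of semiring\<close>

lemma semiring_homD:
  assumes "f \<in> semiring_hom S T"
  shows "x \<in> carrier S \<Longrightarrow> f x \<in> carrier T"
    and "x \<in> carrier S \<Longrightarrow> y \<in> carrier S \<Longrightarrow> f (x \<otimes>\<^bsub>S\<^esub> y) = f x \<otimes>\<^bsub>T\<^esub> f y"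
    and "x \<in> carrier S \<Longrightarrow> y \<in> carrier S \<Longrightarrow> f (x \<oplus>\<^bsub>S\<^esub> y) = f x \<oplus>\<^bsub>T\<^esub> f y"
    and "f \<one>\<^bsub>S\<^esub> = \<one>\<^bsub>T\<^esub>" and "f \<zero>\<^bsub>S\<^esub> = \<zero>\<^bsub>T\<^esub>"
  using assms by (auto simp: semiring_hom_def ring_hom_def)

lemma semiring_hom_id: "(\<lambda>x. x) \<in> semiring_hom S S"
  by (simp add: semiring_hom_def ring_hom_def)

lemma semiring_hom_compose:
  "f \<in> semiring_hom S T \<Longrightarrow> g \<in> semiring_hom T U \<Longrightarrow> g \<circ> f \<in> semiring_hom S U"
  by (auto simp: semiring_hom_def intro: ring_hom_trans)

lemma semiring_hom_cong:
  assumes "semiring S" "f \<in> semiring_hom S T" "\<And>x. x \<in> carrier S \<Longrightarrow> g x = f x"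
  shows "g \<in> semiring_hom S T"
proof -
  interpret S: semiring S by fact
  show ?thesis
    using assms(2,3) by (auto simp: semiring_hom_def ring_hom_def)
qed

lemma semiring_hom_finsum:
  assumes S: "semiring S" and T: "semiring T" and f: "f \<in> semiring_hom S T"
    and "finite I" "y \<in> I \<rightarrow> carrier S"
  shows "f (\<Oplus>\<^bsub>S\<^esub>i\<in>I. y i) = (\<Oplus>\<^bsub>T\<^esub>i\<in>I. f (y i))"
proof -
  interpret S: semiring S by fact
  interpret T: semiring T by fact
  show ?thesis
    using assms(4,5)
    by (induction I rule: finite_induct) (simp_all add: semiring_homD[OF f] Pi_iff)
qed

lemma semiring_hom_matrix_product:
  assumes S: "semiring S" and T: "semiring T" and f: "f \<in> semiring_hom S T"
    and a: "matrix_over S n m a" and b: "matrix_over S m k b" and "i < n" "l < k"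
  shows "(\<Oplus>\<^bsub>T\<^esub>j\<in>{..<m}. f (a i j) \<otimes>\<^bsub>T\<^esub> f (b j l)) = f (\<Oplus>\<^bsub>S\<^esub>j\<in>{..<m}. a i j \<otimes>\<^bsub>S\<^esub> b j l)"
proof -
  interpret S: semiring S by fact
  interpret T: semiring T by fact
  have cl: "a i j \<in> carrier S" "b j l \<in> carrier S" if "j < m" for j
    using assms that by auto
  then have "(\<Oplus>\<^bsub>T\<^esub>j\<in>{..<m}. f (a i j) \<otimes>\<^bsub>T\<^esub> f (b j l)) = (\<Oplus>\<^bsub>T\<^esub>j\<in>{..<m}. f (a i j \<otimes>\<^bsub>S\<^esub> b j l))"
    by (intro T.finsum_cong') (auto simp: semiring_homD[OF f])
  also have "\<dots> = f (\<Oplus>\<^bsub>S\<^esub>j\<in>{..<m}. a i j \<otimes>\<^bsub>S\<^esub> b j l)"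
    by (rule semiring_hom_finsum[OF S T f, symmetric]) (use cl in auto)
  finally show ?thesis .
qed

lemma idempotent_matrix_map:
  assumes "semiring S" "semiring T" "f \<in> semiring_hom S T" and u: "idempotent_matrix S n u"
  shows "idempotent_matrix T n (\<lambda>i j. f (u i j))"
  using u semiring_hom_matrix_product[OF assms(1-3) idempotent_matrix_over[OF u] idempotent_matrix_over[OF u]]
    semiring_homD(1)[OF assms(3)]
  by (simp add: idempotent_matrix_def)

lemma equivalent_idempotents_map:
  assumes "semiring S" "semiring T" and f: "f \<in> semiring_hom S T"
    and equiv: "equivalent_idempotents S n u m v"
  shows "equivalent_idempotents T n (\<lambda>i j. f (u i j)) m (\<lambda>i j. f (v i j))"
proof -
  obtain a b where a: "matrix_over S n m a" and b: "matrix_over S m n b"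
    and ab: "\<forall>i<n. \<forall>k<n. (\<Oplus>\<^bsub>S\<^esub>j\<in>{..<m}. a i j \<otimes>\<^bsub>S\<^esub> b j k) = u i k"
    and ba: "\<forall>i<m. \<forall>k<m. (\<Oplus>\<^bsub>S\<^esub>j\<in>{..<n}. b i j \<otimes>\<^bsub>S\<^esub> a j k) = v i k"
    using equiv unfolding equivalent_idempotents_def by (elim exE conjE) (rule that)
  show ?thesis
    unfolding equivalent_idempotents_def
  proof (intro exI conjI)
    show "matrix_over T n m (\<lambda>i j. f (a i j))" "matrix_over T m n (\<lambda>i j. f (b i j))"
      using a b semiring_homD(1)[OF f] by auto
    show "\<forall>i<n. \<forall>k<n. (\<Oplus>\<^bsub>T\<^esub>j\<in>{..<m}. f (a i j) \<otimes>\<^bsub>T\<^esub> f (b j k)) = f (u i k)"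
      using semiring_hom_matrix_product[OF assms(1-3) a b] ab by simp
    show "\<forall>i<m. \<forall>k<m. (\<Oplus>\<^bsub>T\<^esub>j\<in>{..<n}. f (b i j) \<otimes>\<^bsub>T\<^esub> f (a j k)) = f (v i k)"
      using semiring_hom_matrix_product[OF assms(1-3) b a] ba by simp
  qed
qed

lemma row_semimodule_cong:
  assumes "\<And>i j. i < n \<Longrightarrow> j < n \<Longrightarrow> u i j = v i j"
  shows "row_semimodule S n u = row_semimodule S n v"
proof -
  have "(\<lambda>i. \<lambda>j\<in>{..<n}. u i j) ` {..<n} = (\<lambda>i. \<lambda>j\<in>{..<n}. v i j) ` {..<n}"
    using assms by (intro image_cong) auto
  then show ?thesis by (simp only: row_semimodule_def)
qed

section \<open>Direct sums and block matrices\<close>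

definition block_diagonal ::
    "'a ring \<Rightarrow> nat \<Rightarrow> (nat \<Rightarrow> nat \<Rightarrow> 'a) \<Rightarrow> (nat \<Rightarrow> nat \<Rightarrow> 'a) \<Rightarrow> nat \<Rightarrow> nat \<Rightarrow> 'a"
  where "block_diagonal S n u v = (\<lambda>i j.
    if i < n \<and> j < n then u i j else if n \<le> i \<and> n \<le> j then v (i - n) (j - n) else \<zero>\<^bsub>S\<^esub>)"

definition concat_rows :: "nat \<Rightarrow> nat \<Rightarrow> (nat \<Rightarrow> 'a) \<Rightarrow> (nat \<Rightarrow> 'a) \<Rightarrow> nat \<Rightarrow> 'a"
  where "concat_rows n m y z = (\<lambda>i\<in>{..<n + m}. if i < n then y i else z (i - n))"

definition tail_row :: "nat \<Rightarrow> nat \<Rightarrow> (nat \<Rightarrow> 'a) \<Rightarrow> nat \<Rightarrow> 'a"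
  where "tail_row n m x = (\<lambda>i\<in>{..<m}. x (n + i))"

lemma (in abelian_monoid) finsum_lessThan_add:
  fixes n m :: nat
  assumes "y \<in> {..<n + m} \<rightarrow> carrier G"
  shows "(\<Oplus>i\<in>{..<n + m}. y i) = (\<Oplus>i\<in>{..<n}. y i) \<oplus> (\<Oplus>i\<in>{..<m}. y (n + i))"
  using assms
proof (induction m)
  case 0
  then show ?case by simp
next
  case (Suc m)
  then have cl: "y \<in> {..<n + m} \<rightarrow> carrier G" "y (n + m) \<in> carrier G" by auto
  then have "y \<in> {..<n} \<rightarrow> carrier G" "(\<lambda>i. y (n + i)) \<in> {..<m} \<rightarrow> carrier G" by auto
  with cl Suc.IH[OF cl(1)] show ?case
    by (simp add: lessThan_Suc a_lcomm)
qed

text \<open>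
  The sum splits at \<open>n\<close>, and the entries of the block that does not meet column \<open>j\<close> vanish.
\<close>

lemma finsum_block_diagonal:
  assumes S: "semiring S" and u: "matrix_over S n n u" and v: "matrix_over S m m v"
    and x: "\<And>i. i < n + m \<Longrightarrow> x i \<in> carrier S" and j: "j < n + m"
  shows "(\<Oplus>\<^bsub>S\<^esub>i\<in>{..<n + m}. x i \<otimes>\<^bsub>S\<^esub> block_diagonal S n u v i j) =
    (if j < n then \<Oplus>\<^bsub>S\<^esub>i\<in>{..<n}. x i \<otimes>\<^bsub>S\<^esub> u i j
     else \<Oplus>\<^bsub>S\<^esub>i\<in>{..<m}. x (n + i) \<otimes>\<^bsub>S\<^esub> v i (j - n))"
proof -
  interpret S: semiring S by fact
  have "block_diagonal S n u v i j \<in> carrier S" if "i < n + m" for i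
    using u v j that by (auto simp: block_diagonal_def)
  then have "(\<Oplus>\<^bsub>S\<^esub>i\<in>{..<n + m}. x i \<otimes>\<^bsub>S\<^esub> block_diagonal S n u v i j) =
      (\<Oplus>\<^bsub>S\<^esub>i\<in>{..<n}. x i \<otimes>\<^bsub>S\<^esub> block_diagonal S n u v i j) \<oplus>\<^bsub>S\<^esub>
      (\<Oplus>\<^bsub>S\<^esub>i\<in>{..<m}. x (n + i) \<otimes>\<^bsub>S\<^esub> block_diagonal S n u v (n + i) j)"
    using x by (intro S.finsum_lessThan_add) auto
  also have "(\<Oplus>\<^bsub>S\<^esub>i\<in>{..<n}. x i \<otimes>\<^bsub>S\<^esub> block_diagonal S n u v i j) =
      (if j < n then \<Oplus>\<^bsub>S\<^esub>i\<in>{..<n}. x i \<otimes>\<^bsub>S\<^esub> u i j else \<zero>\<^bsub>S\<^esub>)"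
    using x u by (auto intro!: S.finsum_cong' S.add.finprod_one_eqI simp: block_diagonal_def)
  also have "(\<Oplus>\<^bsub>S\<^esub>i\<in>{..<m}. x (n + i) \<otimes>\<^bsub>S\<^esub> block_diagonal S n u v (n + i) j) =
      (if j < n then \<zero>\<^bsub>S\<^esub> else \<Oplus>\<^bsub>S\<^esub>i\<in>{..<m}. x (n + i) \<otimes>\<^bsub>S\<^esub> v i (j - n))"
    using x v j by (auto intro!: S.finsum_cong' S.add.finprod_one_eqI simp: block_diagonal_def)
  finally show ?thesis
    using x u v j by (auto intro!: S.finsum_closed S.r_zero S.l_zero simp: Pi_iff)
qed

lemma idempotent_block_diagonal:
  assumes S: "semiring S" and u: "idempotent_matrix S n u" and v: "idempotent_matrix S m v"
  shows "idempotent_matrix S (n + m) (block_diagonal S n u v)"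
  unfolding idempotent_matrix_def
proof (intro conjI allI impI)
  interpret S: semiring S by fact
  let ?w = "block_diagonal S n u v"
  note over = idempotent_matrix_over[OF u] idempotent_matrix_over[OF v]
  show w: "?w i j \<in> carrier S" if "i < n + m" "j < n + m" for i j
    using over that by (auto simp: block_diagonal_def)
  fix i j assume i: "i < n + m" and j: "j < n + m"
  have "(\<Oplus>\<^bsub>S\<^esub>k\<in>{..<n}. ?w i k \<otimes>\<^bsub>S\<^esub> u k j) = ?w i j" if "j < n"
  proof -
    have "(\<Oplus>\<^bsub>S\<^esub>k\<in>{..<n}. ?w i k \<otimes>\<^bsub>S\<^esub> u k j) =
        (if i < n then \<Oplus>\<^bsub>S\<^esub>k\<in>{..<n}. u i k \<otimes>\<^bsub>S\<^esub> u k j else \<zero>\<^bsub>S\<^esub>)"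
      using over that by (auto intro!: S.finsum_cong' S.add.finprod_one_eqI simp: block_diagonal_def)
    then show ?thesis using u that by (simp add: idempotent_matrix_def block_diagonal_def)
  qed
  moreover have "(\<Oplus>\<^bsub>S\<^esub>k\<in>{..<m}. ?w i (n + k) \<otimes>\<^bsub>S\<^esub> v k (j - n)) = ?w i j" if "\<not> j < n"
  proof -
    have "(\<Oplus>\<^bsub>S\<^esub>k\<in>{..<m}. ?w i (n + k) \<otimes>\<^bsub>S\<^esub> v k (j - n)) =
        (if i < n then \<zero>\<^bsub>S\<^esub>
         else \<Oplus>\<^bsub>S\<^esub>k\<in>{..<m}. v (i - n) k \<otimes>\<^bsub>S\<^esub> v k (j - n))"
      using over i j that by (auto intro!: S.finsum_cong' S.add.finprod_one_eqI simp: block_diagonal_def)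
    then show ?thesis using v i j that by (simp add: idempotent_matrix_def block_diagonal_def)
  qed
  ultimately show "(\<Oplus>\<^bsub>S\<^esub>k\<in>{..<n + m}. ?w i k \<otimes>\<^bsub>S\<^esub> ?w k j) = ?w i j"
    using finsum_block_diagonal[OF S over, of "?w i" j] w[OF i] j by simp
qed

lemma concat_rows_closed:
  assumes "y \<in> carrier (free_semimodule S n)" "z \<in> carrier (free_semimodule S m)"
  shows "concat_rows n m y z \<in> carrier (free_semimodule S (n + m))"
  using assms by (auto simp: concat_rows_def carrier_free PiE_iff)

lemma split_row_closed:
  assumes "x \<in> carrier (free_semimodule S (n + m))"
  shows "restrict x {..<n} \<in> carrier (free_semimodule S n)"
    and "tail_row n m x \<in> carrier (free_semimodule S m)"
  using assms by (auto simp: tail_row_def carrier_free PiE_iff)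

lemma concat_split_row:
  "x \<in> carrier (free_semimodule S (n + m)) \<Longrightarrow>
    concat_rows n m (restrict x {..<n}) (tail_row n m x) = x"
  by (auto simp: concat_rows_def tail_row_def carrier_free PiE_iff extensional_def fun_eq_iff)

lemma split_concat_rows:
  assumes "y \<in> carrier (free_semimodule S n)" "z \<in> carrier (free_semimodule S m)"
  shows "restrict (concat_rows n m y z) {..<n} = y" "tail_row n m (concat_rows n m y z) = z"
  using assms by (auto simp: concat_rows_def tail_row_def carrier_free PiE_iff extensional_def fun_eq_iff)

lemma row_times_block_diagonal:
  assumes S: "semiring S" and u: "matrix_over S n n u" and v: "matrix_over S m m v"
    and x: "x \<in> carrier (free_semimodule S (n + m))"
  shows "row_times S (n + m) (n + m) x (block_diagonal S n u v) =
    concat_rows n m (row_times S n n (restrict x {..<n}) u) (row_times S m m (tail_row n m x) v)"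
proof -
  interpret S: semiring S by fact
  have xi: "x i \<in> carrier S" if "i < n + m" for i using x that by (auto simp: carrier_free)
  have "(\<Oplus>\<^bsub>S\<^esub>i\<in>{..<n}. restrict x {..<n} i \<otimes>\<^bsub>S\<^esub> u i j) = (\<Oplus>\<^bsub>S\<^esub>i\<in>{..<n}. x i \<otimes>\<^bsub>S\<^esub> u i j)"
    if "j < n" for j
    using xi u that by (intro S.finsum_cong') auto
  moreover have "(\<Oplus>\<^bsub>S\<^esub>i\<in>{..<m}. tail_row n m x i \<otimes>\<^bsub>S\<^esub> v i j) = (\<Oplus>\<^bsub>S\<^esub>i\<in>{..<m}. x (n + i) \<otimes>\<^bsub>S\<^esub> v i j)"
    if "j < m" for j
    using xi v that by (intro S.finsum_cong') (auto simp: tail_row_def)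
  ultimately show ?thesis
    by (auto simp: row_times_def concat_rows_def finsum_block_diagonal[OF S u v xi] fun_eq_iff)
qed

lemma block_diagonal_row_semimodule_iff:
  assumes S: "semiring S" and u: "idempotent_matrix S n u" and v: "idempotent_matrix S m v"
    and x: "x \<in> carrier (free_semimodule S (n + m))"
  shows "x \<in> carrier (row_semimodule S (n + m) (block_diagonal S n u v)) \<longleftrightarrow>
    restrict x {..<n} \<in> carrier (row_semimodule S n u) \<and>
    tail_row n m x \<in> carrier (row_semimodule S m v)"
proof -
  note over = idempotent_matrix_over[OF u] idempotent_matrix_over[OF v]
  note split = split_row_closed[OF x]
  let ?y = "row_times S n n (restrict x {..<n}) u" and ?z = "row_times S m m (tail_row n m x) v"
  note cl = row_times_closed[OF S split(1) over(1)] row_times_closed[OF S split(2) over(2)]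
  have "concat_rows n m ?y ?z = x \<longleftrightarrow> ?y = restrict x {..<n} \<and> ?z = tail_row n m x"
    using concat_split_row[OF x] split_concat_rows[OF cl] by metis
  then show ?thesis
    using x split
    by (simp add: carrier_row_semimodule[OF S] u v idempotent_block_diagonal[OF S u v]
        row_times_block_diagonal[OF S over])
qed

lemma row_semimodule_block_diagonal_iso:
  assumes S: "semiring S" and u: "idempotent_matrix S n u" and v: "idempotent_matrix S m v"
  shows "semimodule_iso S (row_semimodule S (n + m) (block_diagonal S n u v))
    (direct_sum (row_semimodule S n u) (row_semimodule S m v))" (is "semimodule_iso S ?R ?D")
proof -
  let ?h = "\<lambda>x. (restrict x {..<n}, tail_row n m x)"
  note mem = block_diagonal_row_semimodule_iff[OF S u v]
  have RF: "x \<in> carrier (free_semimodule S (n + m))" if "x \<in> carrier ?R" for x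
    using that by (simp add: carrier_row_semimodule[OF S idempotent_block_diagonal[OF S u v]])
  have D: "carrier ?D = carrier (row_semimodule S n u) \<times> carrier (row_semimodule S m v)"
    by (simp add: direct_sum_def)
  have DF: "y \<in> carrier (free_semimodule S n)" "z \<in> carrier (free_semimodule S m)"
    if "(y, z) \<in> carrier ?D" for y z
    using that by (simp_all add: D carrier_row_semimodule[OF S u] carrier_row_semimodule[OF S v])
  have to: "?h x \<in> carrier ?D" if "x \<in> carrier ?R" for x
    using mem[OF RF[OF that]] that by (simp add: D)
  have "?h \<in> semimodule_hom S ?R ?D"
  proof (rule semimodule_homI)
    show "?h \<zero>\<^bsub>?R\<^esub> = \<zero>\<^bsub>?D\<^esub>"
      by (auto simp: row_semimodule_simps direct_sum_def free_semimodule_def tail_row_def)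
    show "?h (x \<oplus>\<^bsub>?R\<^esub> y) = ?h x \<oplus>\<^bsub>?D\<^esub> ?h y" for x y
      by (auto simp: row_semimodule_simps direct_sum_def free_semimodule_def tail_row_def)
    show "?h (a \<odot>\<^bsub>?R\<^esub> x) = a \<odot>\<^bsub>?D\<^esub> ?h x" for a x
      by (auto simp: row_semimodule_simps direct_sum_def free_semimodule_def tail_row_def)
  qed (rule to)
  moreover have "bij_betw ?h (carrier ?R) (carrier ?D)"
  proof (rule bij_betw_byWitness[where f' = "\<lambda>(y, z). concat_rows n m y z"])
    show "\<forall>x\<in>carrier ?R. (case ?h x of (y, z) \<Rightarrow> concat_rows n m y z) = x"
      using concat_split_row[OF RF] by simp
    show "\<forall>p\<in>carrier ?D. ?h (case p of (y, z) \<Rightarrow> concat_rows n m y z) = p"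
      using split_concat_rows[OF DF] by auto
    show "?h ` carrier ?R \<subseteq> carrier ?D" using to by auto
    show "(\<lambda>(y, z). concat_rows n m y z) ` carrier ?D \<subseteq> carrier ?R"
    proof (rule image_subsetI, clarify)
      fix y z assume yz: "(y, z) \<in> carrier ?D"
      then show "concat_rows n m y z \<in> carrier ?R"
        using mem[OF concat_rows_closed[OF DF[OF yz]]] split_concat_rows[OF DF[OF yz]]
        by (simp add: D)
    qed
  qed
  ultimately show ?thesis
    unfolding semimodule_iso_def by (intro bexI)
qed

lemma direct_sum_iso:
  assumes "semimodule_iso S M M'" "semimodule_iso S N N'"
  shows "semimodule_iso S (direct_sum M N) (direct_sum M' N')"
proof -
  obtain g h where g: "g \<in> semimodule_hom S M M'" "bij_betw g (carrier M) (carrier M')"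
    and h: "h \<in> semimodule_hom S N N'" "bij_betw h (carrier N) (carrier N')"
    using assms unfolding semimodule_iso_def by blast
  have "map_prod g h \<in> semimodule_hom S (direct_sum M N) (direct_sum M' N')"
    by (rule semimodule_homI)
      (auto simp: direct_sum_def semimodule_homD[OF g(1)] semimodule_homD[OF h(1)])
  moreover have "bij_betw (map_prod g h) (carrier (direct_sum M N)) (carrier (direct_sum M' N'))"
    using bij_betw_map_prod[OF g(2) h(2)] by (simp add: direct_sum_def)
  ultimately show ?thesis
    unfolding semimodule_iso_def by (intro bexI)
qed

text \<open>
  The \<open>0 \<times> 0\<close> matrix has no entries, so every \<open>u\<close> represents it. The only vector of length \<open>0\<close> is
  the extensional function with empty domain.
\<close>

lemma zero_semimodule_iso_row:
  assumes S: "semiring S"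
  shows "semimodule_iso S zero_semimodule (row_semimodule S 0 u)"
proof -
  have "idempotent_matrix S 0 u" by (simp add: idempotent_matrix_def)
  then have carrier: "carrier (row_semimodule S 0 u) = {\<lambda>_. undefined}"
    by (auto simp: carrier_row_semimodule[OF S] carrier_free row_times_def)
  have "(\<lambda>_. \<lambda>_. undefined) \<in> semimodule_hom S zero_semimodule (row_semimodule S 0 u)"
    by (rule semimodule_homI)
      (auto simp: carrier row_semimodule_simps zero_semimodule_def free_semimodule_def)
  moreover have "bij_betw (\<lambda>_. \<lambda>_. undefined) (carrier zero_semimodule) (carrier (row_semimodule S 0 u))"
    unfolding carrier by (simp add: zero_semimodule_def bij_betw_def)
  ultimately show ?thesis
    unfolding semimodule_iso_def by (intro bexI)
qed

section \<open>The monoid of isomorphism classes\<close>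

lemma iso_class_row_in_PF:
  assumes "semiring S" "idempotent_matrix S n u"
  shows "iso_class S (row_semimodule S n u) \<in> carrier (PF S)"
  using fg_projective_row[OF assms] by (auto simp: PF_def)

lemma PF_carrierE:
  assumes S: "semiring S" and "p \<in> carrier (PF S)"
  obtains n u where "idempotent_matrix S n u" "p = iso_class S (row_semimodule S n u)"
proof -
  obtain P :: "('a, nat \<Rightarrow> 'a) module" where P: "fg_projective S P" "p = iso_class S P"
    using assms(2) by (auto simp: PF_def)
  obtain n u where u: "idempotent_matrix S n u" "semimodule_iso S P (row_semimodule S n u)"
    using fg_projective_iso_row[OF S P(1)] .
  have "p = iso_class S (row_semimodule S n u)"
    unfolding P(2) using P(1) u(2) by (intro iso_class_eqI) (simp_all add: fg_projective_def)
  with u(1) show thesis by (rule that)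
qed

lemma PF_one:
  assumes S: "semiring S"
  shows "\<one>\<^bsub>PF S\<^esub> = iso_class S (row_semimodule S 0 u)"
proof -
  interpret S: semiring S by fact
  have "left_semimodule S (zero_semimodule :: ('a, unit) module)"
  proof -
    have "abelian_monoid (zero_semimodule :: ('a, unit) module)"
      by (rule abelian_monoidI) (auto simp: zero_semimodule_def)
    then interpret Z: abelian_monoid "zero_semimodule :: ('a, unit) module" .
    show ?thesis by unfold_locales (auto simp: zero_semimodule_def)
  qed
  from iso_class_eqI[OF this zero_semimodule_iso_row[OF S]] show ?thesis
    by (simp add: PF_def)
qed

text \<open>
  The product in \<^const>\<open>PF\<close> is a union over all pairs of representatives; each pair contributes the
  same class.
\<close>

lemma PF_mult_row:
  assumes S: "semiring S" and u: "idempotent_matrix S n u" and v: "idempotent_matrix S m v"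
  shows "iso_class S (row_semimodule S n u) \<otimes>\<^bsub>PF S\<^esub> iso_class S (row_semimodule S m v) =
    iso_class S (row_semimodule S (n + m) (block_diagonal S n u v))"
proof -
  let ?U = "row_semimodule S n u" and ?V = "row_semimodule S m v"
  let ?W = "row_semimodule S (n + m) (block_diagonal S n u v)"
  have eq: "iso_class S (direct_sum P Q) = iso_class S ?W"
    if "P \<in> iso_class S ?U" "Q \<in> iso_class S ?V" for P Q
  proof -
    have "semimodule_iso S (direct_sum ?U ?V) (direct_sum P Q)"
      using that by (intro direct_sum_iso) (simp_all add: iso_class_def)
    with row_semimodule_block_diagonal_iso[OF S u v] have "semimodule_iso S ?W (direct_sum P Q)"
      by (rule semimodule_iso_trans)
    from iso_class_eqI[OF left_semimodule_row[OF S idempotent_block_diagonal[OF S u v]] this]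
    show ?thesis by simp
  qed
  have "?U \<in> iso_class S ?U" "?V \<in> iso_class S ?V"
    using fg_projective_row[OF S] u v by (simp_all add: iso_class_def semimodule_iso_refl)
  then have "(\<Union>P\<in>iso_class S ?U. \<Union>Q\<in>iso_class S ?V. iso_class S (direct_sum P Q)) = iso_class S ?W"
    using eq by blast
  then show ?thesis by (simp add: PF_def)
qed

lemma PF_mult_closed:
  assumes S: "semiring S" and "p \<in> carrier (PF S)" "q \<in> carrier (PF S)"
  shows "p \<otimes>\<^bsub>PF S\<^esub> q \<in> carrier (PF S)"
  using assms(2,3)
  by (elim PF_carrierE[OF S])
    (simp add: PF_mult_row[OF S] iso_class_row_in_PF[OF S] idempotent_block_diagonal[OF S])

text \<open>
  Two presentations \<open>u\<close>, \<open>v\<close> of the same class are equivalent idempotents, hence so are their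
  images under \<open>f\<close>, which therefore present the same class over \<open>T\<close>. Thus the description in
  \<^const>\<open>PF_map\<close> is definite.
\<close>

lemma PF_map_row:
  assumes S: "semiring S" and T: "semiring T" and f: "f \<in> semiring_hom S T"
    and u: "idempotent_matrix S n u"
  shows "PF_map S T f (iso_class S (row_semimodule S n u)) =
    iso_class T (row_semimodule T n (\<lambda>i j. f (u i j)))"
  unfolding PF_map_def
proof (rule the_equality)
  fix q assume "\<exists>m v. idempotent_matrix S m v \<and>
    iso_class S (row_semimodule S n u) = iso_class S (row_semimodule S m v) \<and>
    q = iso_class T (row_semimodule T m (\<lambda>i j. f (v i j)))"
  then obtain m v where v: "idempotent_matrix S m v"
    and same: "iso_class S (row_semimodule S n u) = iso_class S (row_semimodule S m v)"
    and q: "q = iso_class T (row_semimodule T m (\<lambda>i j. f (v i j)))"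
    by blast
  have "equivalent_idempotents S n u m v"
    using same iso_class_eq_iff[OF fg_projective_row[OF S u] fg_projective_row[OF S v]]
    by (simp add: row_semimodule_iso_iff[OF S u v])
  from equivalent_idempotents_map[OF S T f this]
  have "semimodule_iso T (row_semimodule T n (\<lambda>i j. f (u i j))) (row_semimodule T m (\<lambda>i j. f (v i j)))"
    using row_semimodule_iso_iff[OF T] idempotent_matrix_map[OF S T f] u v by simp
  then show "q = iso_class T (row_semimodule T n (\<lambda>i j. f (u i j)))"
    unfolding q
    by (rule iso_class_eqI[OF left_semimodule_row[OF T idempotent_matrix_map[OF S T f u]], symmetric])
qed (use u in blast)

lemma PF_map_hom:
  assumes S: "semiring S" and T: "semiring T" and f: "f \<in> semiring_hom S T"
  shows "PF_map S T f \<in> hom (PF S) (PF T)"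
proof (rule homI)
  fix p assume "p \<in> carrier (PF S)"
  then show "PF_map S T f p \<in> carrier (PF T)"
    by (elim PF_carrierE[OF S])
      (simp add: PF_map_row[OF S T f] iso_class_row_in_PF[OF T] idempotent_matrix_map[OF S T f])
next
  fix p q assume "p \<in> carrier (PF S)" "q \<in> carrier (PF S)"
  then obtain n u m v where u: "idempotent_matrix S n u" "p = iso_class S (row_semimodule S n u)"
    and v: "idempotent_matrix S m v" "q = iso_class S (row_semimodule S m v)"
    by (elim PF_carrierE[OF S]) (rule that)
  let ?f = "\<lambda>w i j. f (w i j)"
  have "?f (block_diagonal S n u v) = block_diagonal T n (?f u) (?f v)"
    by (simp add: block_diagonal_def fun_eq_iff semiring_homD(5)[OF f])
  then show "PF_map S T f (p \<otimes>\<^bsub>PF S\<^esub> q) = PF_map S T f p \<otimes>\<^bsub>PF T\<^esub> PF_map S T f q"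
    unfolding u(2) v(2) PF_mult_row[OF S u(1) v(1)] PF_map_row[OF S T f u(1)]
      PF_map_row[OF S T f v(1)] PF_map_row[OF S T f idempotent_block_diagonal[OF S u(1) v(1)]]
    by (simp add: PF_mult_row[OF T] idempotent_matrix_map[OF S T f] u(1) v(1))
qed

text \<open>
  Both units are presented by \<open>0 \<times> 0\<close> matrices; of the functions that represent the one over \<open>T\<close>,
  the entrywise image of the one over \<open>S\<close> is taken.
\<close>

lemma PF_map_one:
  assumes S: "semiring S" and T: "semiring T" and f: "f \<in> semiring_hom S T"
  shows "PF_map S T f \<one>\<^bsub>PF S\<^esub> = \<one>\<^bsub>PF T\<^esub>"
  unfolding PF_one[OF S, of undefined] PF_one[OF T, of "\<lambda>i j. f (undefined i j)"]
  by (rule PF_map_row[OF S T f]) (simp add: idempotent_matrix_def)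

lemma PF_map_id:
  assumes S: "semiring S" and "p \<in> carrier (PF S)"
  shows "PF_map S S (\<lambda>x. x) p = p"
  using assms(2) by (elim PF_carrierE[OF S]) (simp add: PF_map_row[OF S S semiring_hom_id])

lemma PF_map_compose:
  assumes S: "semiring S" and T: "semiring T" and U: "semiring U"
    and f: "f \<in> semiring_hom S T" and g: "g \<in> semiring_hom T U" and "p \<in> carrier (PF S)"
  shows "PF_map S U (g \<circ> f) p = PF_map T U g (PF_map S T f p)"
  using assms(6)
  by (elim PF_carrierE[OF S])
    (simp add: PF_map_row[OF S U semiring_hom_compose[OF f g]] PF_map_row[OF S T f]
      PF_map_row[OF T U g] idempotent_matrix_map[OF S T f])

text \<open>
  Arrows of the category of semirings are extensional, so identities and composites there agree
  with \<open>\<lambda>x. x\<close> and \<open>g \<circ> f\<close> on the carrier only.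
\<close>

lemma PF_map_cong:
  assumes S: "semiring S" and T: "semiring T" and f: "f \<in> semiring_hom S T"
    and eq: "\<And>x. x \<in> carrier S \<Longrightarrow> g x = f x" and "p \<in> carrier (PF S)"
  shows "PF_map S T g p = PF_map S T f p"
proof -
  obtain n u where u: "idempotent_matrix S n u" and p: "p = iso_class S (row_semimodule S n u)"
    using PF_carrierE[OF S assms(5)] .
  have "row_semimodule T n (\<lambda>i j. g (u i j)) = row_semimodule T n (\<lambda>i j. f (u i j))"
    using idempotent_matrix_over[OF u] by (intro row_semimodule_cong) (simp add: eq)
  then show ?thesis
    unfolding p by (simp add: PF_map_row[OF S T _ u] f semiring_hom_cong[OF S f eq])
qed

section \<open>The universal property of the Grothendieck group\<close>

lemma K0_relations_subset:
  assumes S: "semiring S"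
  shows "{frag_of p + frag_of q - frag_of (p \<otimes>\<^bsub>PF S\<^esub> q) | p q.
      p \<in> carrier (PF S) \<and> q \<in> carrier (PF S)} \<subseteq> carrier (free_Abelian_group (carrier (PF S)))"
proof clarify
  fix p q assume "p \<in> carrier (PF S)" "q \<in> carrier (PF S)"
  moreover from this have "p \<otimes>\<^bsub>PF S\<^esub> q \<in> carrier (PF S)" by (rule PF_mult_closed[OF S])
  ultimately show "frag_of p + frag_of q - frag_of (p \<otimes>\<^bsub>PF S\<^esub> q)
      \<in> carrier (free_Abelian_group (carrier (PF S)))"
    using keys_diff[of "frag_of p + frag_of q" "frag_of (p \<otimes>\<^bsub>PF S\<^esub> q)"]
      keys_add[of "frag_of p" "frag_of q"] by auto
qed

lemma K0_relations_subgroup: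
  assumes "semiring S"
  shows "subgroup (K0_relations S) (free_Abelian_group (carrier (PF S)))"
  unfolding K0_relations_def
  by (rule group.generate_is_subgroup[OF group_free_Abelian_group K0_relations_subset[OF assms]])

lemma K0_relations_normal:
  assumes "semiring S"
  shows "K0_relations S \<lhd> free_Abelian_group (carrier (PF S))"
  using comm_group.normal_iff_subgroup[OF abelian_free_Abelian_group] K0_relations_subgroup[OF assms]
  by blast

lemma comm_group_K0: "semiring S \<Longrightarrow> comm_group (K0 S)"
  unfolding K0_def
  by (rule comm_group.abelian_FactGroup[OF abelian_free_Abelian_group K0_relations_subgroup])

lemma K0_projection_hom:
  assumes "semiring S"
  shows "(\<lambda>x. K0_relations S #>\<^bsub>free_Abelian_group (carrier (PF S))\<^esub> x)
    \<in> hom (free_Abelian_group (carrier (PF S))) (K0 S)"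
  unfolding K0_def by (rule normal.r_coset_hom_Mod[OF K0_relations_normal[OF assms]])

text \<open>
  Modulo the relations, \<open>[p] + [q]\<close> equals \<open>[p \<otimes> q]\<close>, as their difference is one of the generating
  relations.
\<close>

lemma K0_class_hom:
  assumes S: "semiring S"
  shows "K0_class S \<in> hom (PF S) (K0 S)"
proof (rule homI)
  let ?J = "free_Abelian_group (carrier (PF S))"
  note \<pi> = K0_projection_hom[OF S]
  show "K0_class S p \<in> carrier (K0 S)" if "p \<in> carrier (PF S)" for p
    using hom_in_carrier[OF \<pi>, of "frag_of p"] that by (simp add: K0_class_def)
  fix p q assume pq: "p \<in> carrier (PF S)" "q \<in> carrier (PF S)"
  let ?s = "p \<otimes>\<^bsub>PF S\<^esub> q" and ?r = "frag_of p + frag_of q - frag_of (p \<otimes>\<^bsub>PF S\<^esub> q)"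
  have s: "?s \<in> carrier (PF S)" by (rule PF_mult_closed[OF S pq])
  have r: "?r \<in> K0_relations S"
    unfolding K0_relations_def using pq by (intro generate.incl) blast
  then have rJ: "?r \<in> carrier ?J"
    using subgroup.subset[OF K0_relations_subgroup[OF S]] by blast
  have sJ: "frag_of ?s \<in> carrier ?J" using s by simp
  have "K0_class S p \<otimes>\<^bsub>K0 S\<^esub> K0_class S q = K0_relations S #>\<^bsub>?J\<^esub> (frag_of p + frag_of q)"
    using hom_mult[OF \<pi>, of "frag_of p" "frag_of q"] pq by (simp add: K0_class_def)
  also have "frag_of p + frag_of q = ?r \<otimes>\<^bsub>?J\<^esub> frag_of ?s" by simp
  also have "K0_relations S #>\<^bsub>?J\<^esub> \<dots> = (K0_relations S #>\<^bsub>?J\<^esub> ?r) #>\<^bsub>?J\<^esub> frag_of ?s"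
    using subgroup.subset[OF K0_relations_subgroup[OF S]] rJ sJ
    by (intro group.coset_mult_assoc[OF group_free_Abelian_group, symmetric])
  also have "K0_relations S #>\<^bsub>?J\<^esub> ?r = K0_relations S"
    using K0_relations_subgroup[OF S] r by (intro group.coset_join2[OF group_free_Abelian_group rJ])
  finally show "K0_class S ?s = K0_class S p \<otimes>\<^bsub>K0 S\<^esub> K0_class S q"
    by (simp add: K0_class_def)
qed

text \<open>
  Composed with the projection, both homomorphisms are defined on the free Abelian group, where
  they agree on the generators.
\<close>

lemma K0_hom_eqI:
  assumes S: "semiring S" and G: "group G"
    and \<phi>: "\<phi> \<in> hom (K0 S) G" "\<phi> \<in> extensional (carrier (K0 S))"
    and \<psi>: "\<psi> \<in> hom (K0 S) G" "\<psi> \<in> extensional (carrier (K0 S))"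
    and eq: "\<And>p. p \<in> carrier (PF S) \<Longrightarrow> \<phi> (K0_class S p) = \<psi> (K0_class S p)"
  shows "\<phi> = \<psi>"
proof (rule extensionalityI[OF \<phi>(2) \<psi>(2)])
  let ?J = "free_Abelian_group (carrier (PF S))"
  let ?\<pi> = "\<lambda>x. K0_relations S #>\<^bsub>?J\<^esub> x"
  have hom: "group_hom ?J G (\<lambda>x. \<chi> (?\<pi> x))" if "\<chi> \<in> hom (K0 S) G" for \<chi>
    using Group.hom_compose[OF K0_projection_hom[OF S] that] G
    by (simp add: group_hom_def group_hom_axioms_def o_def)
  interpret \<phi>: group_hom ?J G "\<lambda>x. \<phi> (?\<pi> x)" by (rule hom[OF \<phi>(1)])
  interpret \<psi>: group_hom ?J G "\<lambda>x. \<psi> (?\<pi> x)" by (rule hom[OF \<psi>(1)])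
  have agree: "\<phi> (?\<pi> x) = \<psi> (?\<pi> x)" if "Poly_Mapping.keys x \<subseteq> carrier (PF S)" for x
  proof (rule free_Abelian_group_induct[OF that])
    show "\<phi> (?\<pi> 0) = \<psi> (?\<pi> 0)"
      using \<phi>.hom_one \<psi>.hom_one by simp
  next
    fix x y assume "Poly_Mapping.keys x \<subseteq> carrier (PF S)" "Poly_Mapping.keys y \<subseteq> carrier (PF S)"
      and IH: "\<phi> (?\<pi> x) = \<psi> (?\<pi> x)" "\<phi> (?\<pi> y) = \<psi> (?\<pi> y)"
    then have J: "x \<in> carrier ?J" "y \<in> carrier ?J" and xy: "x - y = x \<otimes>\<^bsub>?J\<^esub> inv\<^bsub>?J\<^esub> y"
      by simp_all
    have *: "inv\<^bsub>?J\<^esub> y \<in> carrier ?J" by (rule \<phi>.G.inv_closed[OF J(2)])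
    show "\<phi> (?\<pi> (x - y)) = \<psi> (?\<pi> (x - y))"
      unfolding xy \<phi>.hom_mult[OF J(1) *] \<psi>.hom_mult[OF J(1) *] \<phi>.hom_inv[OF J(2)] \<psi>.hom_inv[OF J(2)]
      by (simp only: IH)
  next
    fix p assume "p \<in> carrier (PF S)"
    then show "\<phi> (?\<pi> (frag_of p)) = \<psi> (?\<pi> (frag_of p))"
      using eq by (simp add: K0_class_def)
  qed
  fix X assume "X \<in> carrier (K0 S)"
  then obtain x where "x \<in> carrier ?J" "X = ?\<pi> x"
    by (auto simp: K0_def FactGroup_def RCOSETS_def)
  then show "\<phi> X = \<psi> X" using agree by simp
qed

text \<open>
  Extend \<open>k\<close> to the free Abelian group; since \<open>k\<close> is multiplicative, the extension kills the
  generating relations and factors through the quotient.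
\<close>

lemma K0_universal:
  assumes S: "semiring S" and G: "comm_group G" and k: "k \<in> hom (PF S) G"
  obtains \<phi> where "\<phi> \<in> hom (K0 S) G" "\<phi> \<in> extensional (carrier (K0 S))"
    "\<And>p. p \<in> carrier (PF S) \<Longrightarrow> \<phi> (K0_class S p) = k p"
proof -
  interpret G: comm_group G by fact
  let ?J = "free_Abelian_group (carrier (PF S))"
  obtain h where h: "h \<in> hom ?J G" and hk: "\<And>p. p \<in> carrier (PF S) \<Longrightarrow> h (frag_of p) = k p"
    by (rule G.free_Abelian_group_universal[of k "carrier (PF S)"])
      (use hom_in_carrier[OF k] in auto)
  interpret h: group_hom ?J G h
    using h by (simp add: group_hom_def group_hom_axioms_def)
  have "h (frag_of p + frag_of q - frag_of (p \<otimes>\<^bsub>PF S\<^esub> q)) = \<one>\<^bsub>G\<^esub>"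
    if pq: "p \<in> carrier (PF S)" "q \<in> carrier (PF S)" for p q
  proof -
    have s: "p \<otimes>\<^bsub>PF S\<^esub> q \<in> carrier (PF S)" by (rule PF_mult_closed[OF S pq])
    have kc: "k p \<in> carrier G" "k q \<in> carrier G" using k pq by (auto simp: hom_def)
    have "frag_of p + frag_of q - frag_of (p \<otimes>\<^bsub>PF S\<^esub> q) =
        (frag_of p \<otimes>\<^bsub>?J\<^esub> frag_of q) \<otimes>\<^bsub>?J\<^esub> inv\<^bsub>?J\<^esub> frag_of (p \<otimes>\<^bsub>PF S\<^esub> q)"
      using s by simp
    also have "h \<dots> = (k p \<otimes>\<^bsub>G\<^esub> k q) \<otimes>\<^bsub>G\<^esub> inv\<^bsub>G\<^esub> k (p \<otimes>\<^bsub>PF S\<^esub> q)"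
      using pq s by (simp only: h.hom_mult h.hom_inv h.G.m_closed h.G.inv_closed
          frag_of_in_free_Abelian_group hk)
    also have "\<dots> = \<one>\<^bsub>G\<^esub>" using kc by (simp add: hom_mult[OF k pq])
    finally show ?thesis .
  qed
  then have "{frag_of p + frag_of q - frag_of (p \<otimes>\<^bsub>PF S\<^esub> q) | p q.
      p \<in> carrier (PF S) \<and> q \<in> carrier (PF S)} \<subseteq> kernel ?J G h"
    using K0_relations_subset[OF S] unfolding kernel_def by blast
  then have "K0_relations S \<subseteq> kernel ?J G h"
    unfolding K0_relations_def by (rule h.G.generate_subgroup_incl[OF _ h.subgroup_kernel])
  then obtain g where g: "g \<in> hom (K0 S) G"
    and gh: "\<And>x. x \<in> carrier ?J \<Longrightarrow> g (K0_relations S #>\<^bsub>?J\<^esub> x) = h x"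
    unfolding K0_def using h.FactGroup_universal_kernel[OF K0_relations_normal[OF S]] by blast
  show thesis
  proof (rule that[of "restrict g (carrier (K0 S))"])
    interpret K: comm_group "K0 S" by (rule comm_group_K0[OF S])
    show "restrict g (carrier (K0 S)) \<in> hom (K0 S) G"
      by (rule homI) (simp_all add: hom_in_carrier[OF g] hom_mult[OF g])
    show "restrict g (carrier (K0 S)) (K0_class S p) = k p" if "p \<in> carrier (PF S)" for p
      using hom_in_carrier[OF K0_class_hom[OF S] that] gh[of "frag_of p"] hk that
      by (simp add: K0_class_def)
  qed simp
qed

lemma K0_map_eqI:
  assumes S: "semiring S" and T: "semiring T"
    and \<phi>: "\<phi> \<in> hom (K0 S) (K0 T)" "\<phi> \<in> extensional (carrier (K0 S))"
      "\<And>p. p \<in> carrier (PF S) \<Longrightarrow> \<phi> (K0_class S p) = K0_class T (PF_map S T f p)"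
  shows "K0_map S T f = \<phi>"
  unfolding K0_map_def
proof (rule the_equality)
  have G: "group (K0 T)" using comm_group_K0[OF T] by (simp add: comm_group_def)
  fix \<psi> assume "\<psi> \<in> hom (K0 S) (K0 T) \<inter> extensional (carrier (K0 S)) \<and>
    (\<forall>p\<in>carrier (PF S). \<psi> (K0_class S p) = K0_class T (PF_map S T f p))"
  then show "\<psi> = \<phi>"
    using \<phi> by (intro K0_hom_eqI[OF S G]) auto
qed (use \<phi> in auto)

lemma K0_map_properties:
  assumes S: "semiring S" and T: "semiring T" and f: "f \<in> semiring_hom S T"
  shows "K0_map S T f \<in> hom (K0 S) (K0 T)" "K0_map S T f \<in> extensional (carrier (K0 S))"
    "p \<in> carrier (PF S) \<Longrightarrow> K0_map S T f (K0_class S p) = K0_class T (PF_map S T f p)"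
proof -
  obtain \<phi> where \<phi>: "\<phi> \<in> hom (K0 S) (K0 T)" "\<phi> \<in> extensional (carrier (K0 S))"
    "\<And>p. p \<in> carrier (PF S) \<Longrightarrow> \<phi> (K0_class S p) = (K0_class T \<circ> PF_map S T f) p"
    by (rule K0_universal[OF S comm_group_K0[OF T]
          Group.hom_compose[OF PF_map_hom[OF S T f] K0_class_hom[OF T]]]) (rule that)
  then have "K0_map S T f = \<phi>" by (intro K0_map_eqI[OF S T]) auto
  with \<phi> show "K0_map S T f \<in> hom (K0 S) (K0 T)" "K0_map S T f \<in> extensional (carrier (K0 S))"
    "p \<in> carrier (PF S) \<Longrightarrow> K0_map S T f (K0_class S p) = K0_class T (PF_map S T f p)"
    by auto
qed

section \<open>Functoriality\<close>

lemma K0_map_cong: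
  assumes S: "semiring S" and T: "semiring T" and f: "f \<in> semiring_hom S T"
    and eq: "\<And>x. x \<in> carrier S \<Longrightarrow> g x = f x"
  shows "K0_map S T g = K0_map S T f"
  using K0_map_properties[OF S T f] PF_map_cong[OF S T f eq] by (intro K0_map_eqI[OF S T]) auto

lemma K0_map_id:
  assumes S: "semiring S"
  shows "K0_map S S (\<lambda>x. x) = (\<lambda>X\<in>carrier (K0 S). X)"
proof (rule K0_map_eqI[OF S S])
  interpret K: comm_group "K0 S" by (rule comm_group_K0[OF S])
  show "(\<lambda>X\<in>carrier (K0 S). X) \<in> hom (K0 S) (K0 S)"
    by (rule homI) auto
qed (auto simp: PF_map_id[OF S] intro: hom_in_carrier[OF K0_class_hom[OF S]])

lemma hom_compose_extensional:
  assumes "monoid G" "f \<in> hom G H" "g \<in> hom H K"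
  shows "compose (carrier G) g f \<in> hom G K"
proof -
  interpret G: monoid G by fact
  show ?thesis
    using assms(2,3) by (auto simp: hom_def compose_def Pi_iff)
qed

lemma K0_map_compose:
  assumes S: "semiring S" and T: "semiring T" and U: "semiring U"
    and f: "f \<in> semiring_hom S T" and g: "g \<in> semiring_hom T U"
  shows "K0_map S U (g \<circ> f) = compose (carrier (K0 S)) (K0_map T U g) (K0_map S T f)"
proof (rule K0_map_eqI[OF S U])
  interpret K: comm_group "K0 S" by (rule comm_group_K0[OF S])
  show "compose (carrier (K0 S)) (K0_map T U g) (K0_map S T f) \<in> hom (K0 S) (K0 U)"
    using K0_map_properties(1)[OF S T f] K0_map_properties(1)[OF T U g]
    by (rule hom_compose_extensional[OF K.monoid_axioms])
  fix p assume p: "p \<in> carrier (PF S)"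
  have "compose (carrier (K0 S)) (K0_map T U g) (K0_map S T f) (K0_class S p) =
      K0_map T U g (K0_map S T f (K0_class S p))"
    by (rule compose_eq[OF hom_in_carrier[OF K0_class_hom[OF S] p]])
  also have "\<dots> = K0_map T U g (K0_class T (PF_map S T f p))"
    by (simp only: K0_map_properties(3)[OF S T f p])
  also have "\<dots> = K0_class U (PF_map T U g (PF_map S T f p))"
    by (rule K0_map_properties(3)[OF T U g hom_in_carrier[OF PF_map_hom[OF S T f] p]])
  also have "\<dots> = K0_class U (PF_map S U (g \<circ> f) p)"
    by (simp only: PF_map_compose[OF S T U f g p])
  finally show "compose (carrier (K0 S)) (K0_map T U g) (K0_map S T f) (K0_class S p) =
      K0_class U (PF_map S U (g \<circ> f) p)" .
qed (rule compose_extensional)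

lemma category_semiring: "category semiring_category"
proof
  fix X Y Z f g
  assume "X \<in> Obj semiring_category" "f \<in> Hom semiring_category X Y" "g \<in> Hom semiring_category Y Z"
  then have "semiring X" "f \<in> semiring_hom X Y" "g \<in> semiring_hom Y Z"
    by (simp_all add: semiring_category_def)
  then have "compose (carrier X) g f \<in> semiring_hom X Z"
    by (rule semiring_hom_cong[OF _ semiring_hom_compose]) (simp add: compose_def)
  then show "Comp semiring_category X Y Z g f \<in> Hom semiring_category X Z"
    by (simp add: semiring_category_def)
next
  fix X assume "X \<in> Obj semiring_category"
  then have "semiring X" by (simp add: semiring_category_def)
  then have "restrict (\<lambda>x. x) (carrier X) \<in> semiring_hom X X"
    by (rule semiring_hom_cong[OF _ semiring_hom_id]) simp
  then show "Id semiring_category X \<in> Hom semiring_category X X"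
    by (simp add: semiring_category_def)
next
  fix X Y f
  assume "X \<in> Obj semiring_category" "f \<in> Hom semiring_category X Y"
  then have f: "f \<in> carrier X \<rightarrow> carrier Y" "f \<in> extensional (carrier X)"
    by (auto simp: semiring_category_def semiring_homD(1))
  show "Comp semiring_category X X Y f (Id semiring_category X) = f"
    "Comp semiring_category X Y Y (Id semiring_category Y) f = f"
    using compose_Id[OF f] Id_compose[OF f] by (simp_all add: semiring_category_def)
next
  fix W X Y Z f g h
  assume "f \<in> Hom semiring_category W X"
  then have "f \<in> carrier W \<rightarrow> carrier X" by (auto simp: semiring_category_def semiring_homD(1))
  from compose_assoc[OF this]
  show "Comp semiring_category W Y Z h (Comp semiring_category W X Y g f) =
      Comp semiring_category W X Z (Comp semiring_category X Y Z h g) f"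
    by (simp add: semiring_category_def)
qed

lemma category_abelian_group: "category abelian_group_category"
proof
  fix X Y Z f g
  assume "X \<in> Obj abelian_group_category" "f \<in> Hom abelian_group_category X Y"
    "g \<in> Hom abelian_group_category Y Z"
  then have "monoid X" "f \<in> hom X Y" "g \<in> hom Y Z"
    by (simp_all add: abelian_group_category_def comm_group_def group_def)
  from hom_compose_extensional[OF this]
  show "Comp abelian_group_category X Y Z g f \<in> Hom abelian_group_category X Z"
    by (simp add: abelian_group_category_def)
next
  fix X assume "X \<in> Obj abelian_group_category"
  then interpret comm_group X by (simp add: abelian_group_category_def)
  have "(\<lambda>x\<in>carrier X. x) \<in> hom X X" by (rule homI) auto
  then show "Id abelian_group_category X \<in> Hom abelian_group_category X X"
    by (simp add: abelian_group_category_def)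
next
  fix X Y f
  assume "X \<in> Obj abelian_group_category" "f \<in> Hom abelian_group_category X Y"
  then have f: "f \<in> carrier X \<rightarrow> carrier Y" "f \<in> extensional (carrier X)"
    by (simp_all add: abelian_group_category_def hom_def)
  show "Comp abelian_group_category X X Y f (Id abelian_group_category X) = f"
    "Comp abelian_group_category X Y Y (Id abelian_group_category Y) f = f"
    using compose_Id[OF f] Id_compose[OF f] by (simp_all add: abelian_group_category_def)
next
  fix W X Y Z f g h
  assume "f \<in> Hom abelian_group_category W X"
  then have "f \<in> carrier W \<rightarrow> carrier X" by (simp add: abelian_group_category_def hom_def)
  from compose_assoc[OF this]
  show "Comp abelian_group_category W Y Z h (Comp abelian_group_category W X Y g f) =
      Comp abelian_group_category W X Z (Comp abelian_group_category X Y Z h g) f"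
    by (simp add: abelian_group_category_def)
qed

lemma category_functor_K0:
  "category_functor semiring_category abelian_group_category K0 K0_map"
proof (intro category_functor.intro category_semiring category_abelian_group
    category_functor_axioms.intro)
  fix X Y f
  assume "X \<in> Obj semiring_category" "Y \<in> Obj semiring_category" "f \<in> Hom semiring_category X Y"
  then show "K0_map X Y f \<in> Hom abelian_group_category (K0 X) (K0 Y)"
    by (simp add: semiring_category_def abelian_group_category_def K0_map_properties)
next
  fix X assume "X \<in> Obj semiring_category"
  then have X: "semiring X" by (simp add: semiring_category_def)
  have "K0_map X X (\<lambda>x\<in>carrier X. x) = K0_map X X (\<lambda>x. x)"
    by (rule K0_map_cong[OF X X semiring_hom_id]) simp
  then show "K0_map X X (Id semiring_category X) = Id abelian_group_category (K0 X)"
    by (simp add: semiring_category_def abelian_group_category_def K0_map_id[OF X])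
next
  fix X Y Z f g
  assume "X \<in> Obj semiring_category" "Y \<in> Obj semiring_category" "Z \<in> Obj semiring_category"
    "f \<in> Hom semiring_category X Y" "g \<in> Hom semiring_category Y Z"
  then have X: "semiring X" and Y: "semiring Y" and Z: "semiring Z"
    and f: "f \<in> semiring_hom X Y" and g: "g \<in> semiring_hom Y Z"
    by (simp_all add: semiring_category_def)
  have "K0_map X Z (compose (carrier X) g f) = K0_map X Z (g \<circ> f)"
    by (rule K0_map_cong[OF X Z semiring_hom_compose[OF f g]]) (simp add: compose_def)
  then show "K0_map X Z (Comp semiring_category X Y Z g f) =
      Comp abelian_group_category (K0 X) (K0 Y) (K0 Z) (K0_map Y Z g) (K0_map X Y f)"
    by (simp add: semiring_category_def abelian_group_category_def K0_map_compose[OF X Y Z f g])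
qed (simp add: semiring_category_def abelian_group_category_def comm_group_K0)

theorem theorem6p6:
  fixes S :: "'a ring" and T :: "'b ring" and U :: "'c ring"
  shows
    "category_functor (semiring_category :: ('a ring, 'a \<Rightarrow> 'a) category) abelian_group_category
       K0 K0_map \<and>
     (\<forall>f. semiring S \<and> semiring T \<and> f \<in> semiring_hom S T \<longrightarrow>
        PF_map S T f \<in> hom (PF S) (PF T) \<and>
        PF_map S T f \<one>\<^bsub>PF S\<^esub> = \<one>\<^bsub>PF T\<^esub> \<and>
        (\<forall>n u. idempotent_matrix S n u \<longrightarrow>
           PF_map S T f (iso_class S (row_semimodule S n u)) =
             iso_class T (row_semimodule T n (\<lambda>i j. f (u i j)))) \<and>
        K0_map S T f \<in> hom (K0 S) (K0 T) \<and>
        (\<forall>p\<in>carrier (PF S). K0_map S T f (K0_class S p) = K0_class T (PF_map S T f p))) \<and>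
     (\<forall>f g. semiring S \<and> semiring T \<and> semiring U \<and>
        f \<in> semiring_hom S T \<and> g \<in> semiring_hom T U \<longrightarrow>
        K0_map S U (g \<circ> f) = compose (carrier (K0 S)) (K0_map T U g) (K0_map S T f))"
  by (intro conjI allI impI ballI category_functor_K0)
    (simp_all add: PF_map_hom PF_map_one PF_map_row K0_map_properties K0_map_compose)

end
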